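(* Let $n\ge2$ and $1\le d\le n-1$, and suppose that $f\in\mathcal T'$. Let $w:\mathbb Z^n\times\mathbf{Gr}(d,n)\to\mathbb R$ be a weight such that $$\sum_{A\in\Omega_k}w(k,A)=1,\qquad \Omega_k:=\{A\in\mathbf{Gr}(d,n):k\perp A\},$$ and the series is absolutely converging for every $k\in\mathbb Z^n$ (the weight does not have to generate a norm or be at most of polynomial decay). Then $$(f,h)=\sum_{A\in\mathbf{Gr}(d,n)}\left(F_{w(\cdot,A)}R_{d,A}f,\,h\right)\qquad\text{for all } h\in\mathcal T.$$ Moreover, if $f$ has zero average and $d=n-1$, then $$f=\sum_{A\in\mathbf{Gr}(d,n)}R_{d,A}f.$$
   Context: $\mathbb T^n=\mathbb R^n/\mathbb Z^n$, $\mathcal T=C^\infty(\mathbb T^n)$, $\mathcal T'$ is the space of distributions on $\mathbb T^n$, and $(u,h)$ denotes the duality pairing of a distribution $u\in\mathcal T'$ with $h\in\mathcal T$. The Fourier coefficients are $\hat f(k)=f(e^{-2\pi ik\cdot x})$, $k\in\mathbb Z^n$; $f$ has zero average if $\hat f(0)=0$. For a function $\omega$ on $\mathbb Z^n$, $F_\omega$ denotes the Fourier multiplier $\widehat{F_\omega u}(k)=\omega(k)\hat u(k)$, so that $(F_\omega u,h)=\sum_{k\in\mathbb Z^n}\omega(k)\hat u(k)\hat h(-k)$. $\mathbf{Gr}(d,n)$ is the (countable) collection of $d$-dimensional linear subspaces of $\mathbb Q^n$, and $k\perp A$ means $k$ is orthogonal to every vector of $A$. For $A\in\mathbf{Gr}(d,n)$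 with a basis of integer vectors $v_1,\dots,v_d\in\mathbb Z^n$, the $d$-plane Radon transform of $f\in\mathcal T$ is $$R_{d,A}f(x)=\int_{[0,1]^d}f(x+t_1v_1+\cdots+t_dv_d)\,dt_1\cdots dt_d,$$ which does not depend on the choice of integer basis of $A$. For $f\in\mathcal T'$, $R_{d,A}f\in\mathcal T'$ is defined by duality, using that $R_{d,A}:\mathcal T\to\mathcal T$ is formally $L^2$ self-adjoint. The last displayed identity is an identity in $\mathcal T'$, the sum being understood by pairing with functions in $\mathcal T$.
   Formalization: The first identity can fail by divergence for d<n-1; it is proved for all h if its right side converges for all h, or for a given h if the double series over (A,k) converges absolutely; unconditionally it is proved with the sum over A taken inside the sum over k. *)

theory Defs
  imports "HOL-Analysis.Analysis"
begin

(* Functions on the torus R^n / Z^n are Z^n-periodic functions on R^n, with n = CARD('n). *)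

definition of_int_vec :: "int ^ 'n \<Rightarrow> 'a::ring_1 ^ 'n" where
  "of_int_vec k = (\<chi> i. of_int (k $ i))"

definition periodic :: "(real ^ 'n \<Rightarrow> complex) \<Rightarrow> bool" where
  "periodic h \<longleftrightarrow> (\<forall>x k. h (x + of_int_vec k) = h x)"

definition partial_deriv :: "'n \<Rightarrow> (real ^ 'n \<Rightarrow> complex) \<Rightarrow> real ^ 'n \<Rightarrow> complex" where
  "partial_deriv i h x = frechet_derivative h (at x) (axis i 1)"

definition iter_partial :: "'n list \<Rightarrow> (real ^ 'n \<Rightarrow> complex) \<Rightarrow> real ^ 'n \<Rightarrow> complex" where
  "iter_partial is h = foldr partial_deriv is h"

definition smooth :: "(real ^ 'n \<Rightarrow> complex) \<Rightarrow> bool" where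
  "smooth h \<longleftrightarrow> (\<forall>is x. iter_partial is h differentiable (at x))"

definition test_functions :: "(real ^ 'n \<Rightarrow> complex) set" where
  "test_functions = {h. periodic h \<and> smooth h}"

definition Ck_norm :: "nat \<Rightarrow> (real ^ 'n \<Rightarrow> complex) \<Rightarrow> real" where
  "Ck_norm N h = (\<Sum>is | length is \<le> N. SUP x. norm (iter_partial is h x))"

(* Continuous linear functionals on the Frechet space of test functions, whose topology is
   given by the norms Ck_norm. The value of a functional u outside test_functions is
   irrelevant; u h is the duality pairing (u, h), which is bilinear, not sesquilinear. *)
definition distribution :: "((real ^ 'n \<Rightarrow> complex) \<Rightarrow> complex) \<Rightarrow> bool" where
  "distribution u \<longleftrightarrow>
     (\<forall>g\<in>test_functions. \<forall>h\<in>test_functions. u (\<lambda>x. g x + h x) = u g + u h) \<and>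
     (\<forall>c. \<forall>h\<in>test_functions. u (\<lambda>x. c * h x) = c * u h) \<and>
     (\<exists>C N. \<forall>h\<in>test_functions. norm (u h) \<le> C * Ck_norm N h)"

definition dist_of_fun :: "(real ^ 'n \<Rightarrow> complex) \<Rightarrow> (real ^ 'n \<Rightarrow> complex) \<Rightarrow> complex" where
  "dist_of_fun g h = (LINT x:cbox 0 1|lborel. g x * h x)"

definition fourier_coeff :: "((real ^ 'n \<Rightarrow> complex) \<Rightarrow> complex) \<Rightarrow> int ^ 'n \<Rightarrow> complex" where
  "fourier_coeff u k = u (\<lambda>x. exp (- 2 * of_real pi * \<i> * of_real (of_int_vec k \<bullet> x)))"

definition multiplier_term ::
  "(int ^ 'n \<Rightarrow> complex) \<Rightarrow> ((real ^ 'n \<Rightarrow> complex) \<Rightarrow> complex) \<Rightarrow> (real ^ 'n \<Rightarrow> complex)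
    \<Rightarrow> int ^ 'n \<Rightarrow> complex" where
  "multiplier_term \<omega> u h k = \<omega> k * fourier_coeff u k * fourier_coeff (dist_of_fun h) (- k)"

(* The pairing (F_omega u, h). For general omega the series need not converge for every test
   function h, in which case infsum returns 0: statements about fourier_multiplier must
   provide summability separately. *)
definition fourier_multiplier ::
  "(int ^ 'n \<Rightarrow> complex) \<Rightarrow> ((real ^ 'n \<Rightarrow> complex) \<Rightarrow> complex) \<Rightarrow> (real ^ 'n \<Rightarrow> complex)
    \<Rightarrow> complex" where
  "fourier_multiplier \<omega> u h = (\<Sum>\<^sub>\<infinity>k. multiplier_term \<omega> u h k)"

definition Gr :: "nat \<Rightarrow> (rat ^ 'n) set set" where
  "Gr d = {A. vec.subspace A \<and> vec.dim A = d}"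

definition perp :: "int ^ 'n \<Rightarrow> (rat ^ 'n) set \<Rightarrow> bool" where
  "perp k A \<longleftrightarrow> (\<forall>a\<in>A. (\<Sum>i\<in>UNIV. of_int (k $ i) * a $ i) = 0)"

definition Omega :: "nat \<Rightarrow> int ^ 'n \<Rightarrow> (rat ^ 'n) set set" where
  "Omega d k = {A \<in> Gr d. perp k A}"

definition int_basis :: "nat \<Rightarrow> (rat ^ 'n) set \<Rightarrow> (nat \<Rightarrow> int ^ 'n) \<Rightarrow> bool" where
  "int_basis d A v \<longleftrightarrow>
     inj_on v {..<d} \<and>
     vec.independent ((\<lambda>i. of_int_vec (v i) :: rat ^ 'n) ` {..<d}) \<and>
     vec.span ((\<lambda>i. of_int_vec (v i)) ` {..<d}) = A"

(* On test functions the integral does not depend on the chosen integer basis of A. *)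
definition radon ::
  "nat \<Rightarrow> (rat ^ 'n) set \<Rightarrow> (real ^ 'n \<Rightarrow> complex) \<Rightarrow> real ^ 'n \<Rightarrow> complex" where
  "radon d A h x =
     (let v = (SOME v. int_basis d A v) in
      LINT t : (\<Pi>\<^sub>E i\<in>{..<d}. {0..1}) | (\<Pi>\<^sub>M i\<in>{..<d}. lborel).
        h (x + (\<Sum>i<d. t i *\<^sub>R of_int_vec (v i))))"

definition radon_dist ::
  "nat \<Rightarrow> (rat ^ 'n) set \<Rightarrow> ((real ^ 'n \<Rightarrow> complex) \<Rightarrow> complex)
    \<Rightarrow> (real ^ 'n \<Rightarrow> complex) \<Rightarrow> complex" where
  "radon_dist d A u h = u (radon d A h)"

end

theory Submission
  imports Defs
begin

text \<open>
  Averaging a character \<open>x \<mapsto> exp (2 \<pi> i k \<bullet> x)\<close> over a rational plane \<open>A\<close> reproduces it when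
  \<open>k \<bottom> A\<close> and annihilates it otherwise, so the Radon transform along \<open>A\<close> is the Fourier multiplier with
  symbol \<open>1\<close> for \<open>k \<bottom> A\<close> and \<open>0\<close> for all other \<open>k\<close> (\<open>radon_torus_char\<close>,
  \<open>fourier_coeff_radon_dist\<close>). The frequency \<open>k\<close> therefore contributes
  \<open>w k A * f^(k) * h^(-k)\<close> to the term of each \<open>A\<close> orthogonal to \<open>k\<close>, where \<open>f^\<close> and
  \<open>h^\<close> are the Fourier coefficients, and the normalisation of
  \<open>w\<close> turns the sum of these contributions over \<open>A\<close> into \<open>f^(k) * h^(-k)\<close>. Summing over \<open>k\<close>
  yields \<open>f h\<close> by the Parseval formula \<open>distribution_parseval\<close>.

  The analysis rests on one description of test functions: they are exactly the trigonometric series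
  whose coefficients decay faster than every power (\<open>trig_series_test_function\<close>,
  \<open>rapid_torus_coeff\<close>, \<open>test_function_eq_trig_series\<close>). Derivatives then act on coefficients, so
  the norms that control a distribution are bounded by tails of absolutely convergent series, which
  proves the Parseval formula; and the Radon transform of a test function, obtained by deleting
  coefficients, is visibly a test function again.

  It remains to interchange the sums over \<open>A\<close> and \<open>k\<close>. When the family over pairs
  \<open>(A, k)\<close> is summable this is Fubini for unordered sums (\<open>has_sum_rows_of_columns\<close>). When
  only the iterated sums converge, but do so for all test functions, the family over pairs is
  summable nevertheless (\<open>summable_on_pairs_of_iterated\<close>): coefficients of a test function may be
  restricted to an arbitrary set of frequencies and multiplied by a polynomial weight, and a
  gliding hump argument (\<open>uniform_column_bound\<close>) converts convergence for all these restrictions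
  into a bound on \<open>\<Sum>A. \<bar>w k A * f^(k) * h^(-k)\<bar>\<close> by a summable function of \<open>k\<close>.

  In codimension one a frequency \<open>k \<noteq> 0\<close> is orthogonal to exactly one hyperplane. The supports of
  the symbols then partition the nonzero frequencies, and the Radon transforms of a
  distribution without mean value add up to it
  (\<open>radon_dist_hyperplanes_has_sum\<close>).
\<close>

section \<open>Unordered sums\<close>

lemma has_sum_finite_sum:
  fixes f :: "'i \<Rightarrow> 'k \<Rightarrow> 'b :: topological_comm_monoid_add"
  assumes "\<And>i. i \<in> I \<Longrightarrow> (f i has_sum s i) A"
  shows "((\<lambda>k. \<Sum>i\<in>I. f i k) has_sum (\<Sum>i\<in>I. s i)) A"
  using assms by (induction I rule: infinite_finite_induct) (auto intro: has_sum_add)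

lemma has_sum_diff:
  fixes f g :: "'k \<Rightarrow> 'b :: real_normed_vector"
  assumes "(f has_sum s) A" "(g has_sum t) A"
  shows "((\<lambda>k. f k - g k) has_sum (s - t)) A"
  using has_sum_add[OF assms(1), of "\<lambda>k. - g k" "- t"] assms(2) by (simp add: has_sum_uminus)

text \<open>
  Writing the tail as a sum over all indices with the finite set masked out keeps it inside the
  family of coefficient sequences, which is the form needed for remainders of Fourier series.
\<close>

lemma infsum_tail_tendsto_0:
  fixes a :: "'k \<Rightarrow> real"
  assumes "a summable_on UNIV"
  shows "((\<lambda>F. \<Sum>\<^sub>\<infinity>k. if k \<in> F then 0 else a k) \<longlongrightarrow> 0) (finite_subsets_at_top UNIV)"
proof -
  have "((\<lambda>F. infsum a UNIV - sum a F) \<longlongrightarrow> infsum a UNIV - infsum a UNIV) (finite_subsets_at_top UNIV)"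
    by (intro tendsto_diff tendsto_const infsum_tendsto assms)
  moreover have "infsum a UNIV - sum a F = (\<Sum>\<^sub>\<infinity>k. if k \<in> F then 0 else a k)" if "finite F" for F
  proof -
    have "(a has_sum (infsum a UNIV - sum a F)) (UNIV - F)"
      by (rule has_sum_Diff[OF has_sum_infsum[OF assms] has_sum_finite[OF that]]) simp
    then have "((\<lambda>k. if k \<in> F then 0 else a k) has_sum (infsum a UNIV - sum a F)) UNIV"
      by (rule has_sum_cong_neutral[THEN iffD1, rotated -1]) auto
    then show ?thesis by (simp add: infsumI)
  qed
  ultimately show ?thesis
    by (auto intro: Lim_transform_eventually eventually_finite_subsets_at_top_weakI)
qed

text \<open>
  The remainder of the series is at most the tail of \<open>\<Sum>k. norm (c k)\<close> at every point, so it tends to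
  \<open>0\<close> uniformly, and integrating over a finite measure preserves this. One instance gives the
  Fourier coefficients of a trigonometric series, another its averages over planes.
\<close>

lemma has_sum_integral_dominated:
  fixes u :: "'k \<Rightarrow> 'a \<Rightarrow> complex"
  assumes "finite_measure M"
    and c: "(\<lambda>k. norm (c k)) summable_on UNIV"
    and u: "\<And>k. u k \<in> borel_measurable M" "\<And>k t. norm (u k t) \<le> 1"
    and S: "S \<in> borel_measurable M" "\<And>t. ((\<lambda>k. c k * u k t) has_sum S t) UNIV"
  shows "((\<lambda>k. c k * (\<integral>t. u k t \<partial>M)) has_sum (\<integral>t. S t \<partial>M)) UNIV"
proof -
  interpret finite_measure M by fact
  define T where "T = (\<Sum>\<^sub>\<infinity>k. norm (c k))"
  have T: "((\<lambda>k. norm (c k)) has_sum T) UNIV"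
    unfolding T_def by (rule has_sum_infsum[OF c])
  have tail: "norm (S t - (\<Sum>k\<in>F. c k * u k t)) \<le> T - (\<Sum>k\<in>F. norm (c k))" if F: "finite F" for F t
  proof (rule norm_infsum_le)
    show "((\<lambda>k. c k * u k t) has_sum (S t - (\<Sum>k\<in>F. c k * u k t))) (UNIV - F)"
      by (rule has_sum_Diff[OF S(2) has_sum_finite[OF F]]) simp
    show "((\<lambda>k. norm (c k)) has_sum (T - (\<Sum>k\<in>F. norm (c k)))) (UNIV - F)"
      by (rule has_sum_Diff[OF T has_sum_finite[OF F]]) simp
    show "norm (c k * u k t) \<le> norm (c k)" for k
      using mult_left_mono[OF u(2)[of k t] norm_ge_zero[of "c k"]] by (simp add: norm_mult)
  qed
  have intu: "integrable M (u k)" for k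
    by (rule integrable_const_bound[of _ 1]) (auto simp: u)
  have intS: "integrable M S"
    by (rule integrable_const_bound[of _ T]) (use tail[of "{}"] S(1) in auto)
  have bound: "norm ((\<Sum>k\<in>F. c k * (\<integral>t. u k t \<partial>M)) - (\<integral>t. S t \<partial>M))
      \<le> measure M (space M) * (T - (\<Sum>k\<in>F. norm (c k)))" if F: "finite F" for F
  proof -
    have "(\<integral>t. S t \<partial>M) - (\<Sum>k\<in>F. c k * (\<integral>t. u k t \<partial>M)) = (\<integral>t. S t - (\<Sum>k\<in>F. c k * u k t) \<partial>M)"
      using intS intu by (simp add: integral_sum)
    also have "norm \<dots> \<le> (\<integral>t. T - (\<Sum>k\<in>F. norm (c k)) \<partial>M)"
      by (rule order.trans[OF integral_norm_bound integral_mono])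
         (use intS intu tail[OF F] in \<open>auto intro!: integrable_norm\<close>)
    finally show ?thesis by (simp add: norm_minus_commute)
  qed
  have "((\<lambda>F. (\<Sum>k\<in>F. c k * (\<integral>t. u k t \<partial>M)) - (\<integral>t. S t \<partial>M)) \<longlongrightarrow> 0) (finite_subsets_at_top UNIV)"
  proof (rule Lim_null_comparison)
    show "\<forall>\<^sub>F F in finite_subsets_at_top UNIV. norm ((\<Sum>k\<in>F. c k * (\<integral>t. u k t \<partial>M)) - (\<integral>t. S t \<partial>M))
      \<le> measure M (space M) * (T - (\<Sum>k\<in>F. norm (c k)))"
      by (rule eventually_finite_subsets_at_top_weakI) (rule bound)
    have "((\<lambda>F. \<Sum>k\<in>F. norm (c k)) \<longlongrightarrow> T) (finite_subsets_at_top UNIV)"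
      using T unfolding has_sum_def .
    then show "((\<lambda>F. measure M (space M) * (T - (\<Sum>k\<in>F. norm (c k)))) \<longlongrightarrow> 0) (finite_subsets_at_top UNIV)"
      by (auto intro!: tendsto_eq_intros)
  qed
  then show ?thesis unfolding has_sum_def by (rule Lim_null[THEN iffD2])
qed

section \<open>Characters of the torus\<close>

definition torus_char :: "int ^ 'n \<Rightarrow> real ^ 'n \<Rightarrow> complex" where
  "torus_char k x = cis (2 * pi * (of_int_vec k \<bullet> x))"

lemma of_int_vec_simps [simp]:
  "of_int_vec 0 = 0"
  "of_int_vec (k + l) = of_int_vec k + of_int_vec l"
  "of_int_vec (- k) = - of_int_vec k"
  by (simp_all add: of_int_vec_def vec_eq_iff)

lemma inner_of_int_vec:
  "of_int_vec k \<bullet> (x :: real ^ 'n) = (\<Sum>i\<in>UNIV. of_int (k $ i) * x $ i)"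
  by (simp add: inner_vec_def of_int_vec_def)

lemma inner_of_int_vec_of_int_vec:
  "of_int_vec k \<bullet> (of_int_vec l :: real ^ 'n) = of_int (\<Sum>i\<in>UNIV. k $ i * l $ i)"
  by (simp add: inner_vec_def of_int_vec_def)

lemma torus_char_add: "torus_char (k + l) x = torus_char k x * torus_char l x"
  by (simp add: torus_char_def cis_mult inner_add_left distrib_left)

lemma torus_char_arg_add: "torus_char k (x + y) = torus_char k x * torus_char k y"
  by (simp add: torus_char_def cis_mult inner_add_right distrib_left)

lemma torus_char_0 [simp]: "torus_char 0 x = 1"
  by (simp add: torus_char_def)

lemma norm_torus_char [simp]: "norm (torus_char k x) = 1"
  by (simp add: torus_char_def)

lemma cnj_torus_char: "cnj (torus_char k x) = torus_char (- k) x"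
  by (simp add: torus_char_def cis_cnj)

lemma torus_char_of_int_vec [simp]: "torus_char k (of_int_vec m) = 1"
  unfolding torus_char_def inner_of_int_vec_of_int_vec
  by (rule cis_multiple_2pi) (rule Ints_of_int)

lemma continuous_torus_char [continuous_intros]:
  "continuous_on S f \<Longrightarrow> continuous_on S (\<lambda>x. torus_char k (f x))"
  unfolding torus_char_def by (intro continuous_intros)

lemma fourier_coeff_eq: "fourier_coeff u k = u (torus_char (- k))"
proof -
  have "torus_char (- k) = (\<lambda>x. exp (- 2 * of_real pi * \<i> * of_real (of_int_vec k \<bullet> x)))"
    by (rule ext) (simp add: torus_char_def cis_conv_exp mult_ac)
  then show ?thesis by (simp add: fourier_coeff_def)
qed

section \<open>Polynomial weights and rapid decay\<close>

text \<open>
  A product over the coordinates, instead of a power of a norm: it dominates every coordinate, and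
  \<open>1 / weight\<^sup>2\<close> factors into one-dimensional summable functions.
\<close>

definition weight :: "int ^ 'n \<Rightarrow> real" where
  "weight k = (\<Prod>i\<in>UNIV. max 1 (real_of_int \<bar>k $ i\<bar>))"

lemma weight_ge_1: "1 \<le> weight k"
  unfolding weight_def by (rule prod_ge_1) simp

lemma weight_pos [simp]: "0 < weight k"
  using weight_ge_1[of k] by linarith

lemma weight_nonneg [simp]: "0 \<le> weight k"
  using weight_pos[of k] by linarith

lemma weight_uminus [simp]: "weight (- k) = weight k"
  by (simp add: weight_def)

lemma abs_component_le_weight: "\<bar>real_of_int (k $ i)\<bar> \<le> weight k"
proof -
  have "\<bar>real_of_int (k $ i)\<bar> \<le> max 1 (real_of_int \<bar>k $ i\<bar>) * 1" by simp
  also have "\<dots> \<le> max 1 (real_of_int \<bar>k $ i\<bar>) * (\<Prod>j\<in>UNIV - {i}. max 1 (real_of_int \<bar>k $ j\<bar>))"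
    by (intro mult_left_mono prod_ge_1) auto
  also have "\<dots> = weight k"
    unfolding weight_def by (subst prod.remove[of UNIV i]) auto
  finally show ?thesis .
qed

lemma sum_inverse_square_le:
  "(\<Sum>j\<in>{-int N..int N}. 1 / (max 1 (real_of_int \<bar>j\<bar>))\<^sup>2) \<le> 5"
proof -
  define q where "q j = 1 / (max 1 (real_of_int \<bar>j\<bar>))\<^sup>2" for j
  have step: "sum q {-int (Suc n)..int (Suc n)} = sum q {-int n..int n} + 2 / (real n + 1)\<^sup>2" for n
  proof -
    have "{-int (Suc n)..int (Suc n)} = insert (int (Suc n)) (insert (- int (Suc n)) {-int n..int n})"
      by auto
    then show ?thesis by (simp add: q_def max_def add.commute)
  qed
  \<comment> \<open>comparison with the telescoping sum of \<open>2 / (j * (j + 1))\<close>; equality holds for \<open>n = 0\<close>\<close>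
  have "sum q {-int (Suc n)..int (Suc n)} \<le> 5 - 2 / real (Suc n)" for n
  proof (induction n)
    case 0
    have "{-1..1::int} = {-1,0,1}" by auto
    then show ?case by (simp add: q_def)
  next
    case (Suc n)
    have "2 / (real (Suc n) + 1)\<^sup>2 \<le> 2 / ((real n + 1) * (real n + 2))"
      unfolding power2_eq_square by (intro frac_le mult_mono) auto
    also have "\<dots> = 2 / real (Suc n) - 2 / real (Suc (Suc n))"
      by (simp add: field_simps)
    finally have "2 / (real (Suc n) + 1)\<^sup>2 \<le> 2 / real (Suc n) - 2 / real (Suc (Suc n))" .
    then show ?case using Suc step[of "Suc n"] by linarith
  qed
  then have "sum q {-int (Suc n)..int (Suc n)} \<le> 5" for n
    by (smt (verit) divide_nonneg_nonneg of_nat_0_le_iff)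
  moreover have "sum q {-int 0..int 0} \<le> 5" by (simp add: q_def)
  ultimately show ?thesis unfolding q_def by (cases N) blast+
qed

text \<open>
  A finite set of frequencies lies in a cube, over which the sum is the \<open>n\<close>-th power of a
  one-dimensional sum.
\<close>

lemma summable_inverse_weight_square:
  "(\<lambda>k :: int ^ 'n. 1 / (weight k)\<^sup>2) summable_on UNIV"
proof (rule nonneg_bdd_above_summable_on)
  define q where "q j = 1 / (max 1 (real_of_int \<bar>j\<bar>))\<^sup>2" for j
  have q0: "q j \<ge> 0" for j by (simp add: q_def)
  have w: "1 / (weight k)\<^sup>2 = (\<Prod>i\<in>UNIV. q (k $ i))" for k :: "int ^ 'n"
    by (simp add: weight_def q_def prod_dividef prod_power_distrib)
  show "0 \<le> 1 / (weight k)\<^sup>2" for k :: "int ^ 'n" by simp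
  have "(\<Sum>k\<in>F. 1 / (weight k)\<^sup>2) \<le> 5 ^ CARD('n)" if F: "finite F" for F :: "(int ^ 'n) set"
  proof -
    define N where "N = (\<Sum>k\<in>F. \<Sum>i\<in>UNIV. nat \<bar>k $ i\<bar>)"
    define B where "B = (UNIV :: 'n set) \<rightarrow>\<^sub>E {-int N..int N}"
    have "nat \<bar>k $ i\<bar> \<le> N" if "k \<in> F" for k i
    proof -
      have "nat \<bar>k $ i\<bar> \<le> (\<Sum>i\<in>UNIV. nat \<bar>k $ i\<bar>)" by (rule member_le_sum) auto
      also have "\<dots> \<le> N" unfolding N_def
        by (rule member_le_sum[where f = "\<lambda>k. \<Sum>i\<in>UNIV. nat \<bar>k $ i\<bar>"]) (use that F in auto)
      finally show ?thesis .
    qed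
    then have *: "-int N \<le> k $ i \<and> k $ i \<le> int N" if "k \<in> F" for k i
      using that by (smt (verit) nat_le_iff)
    have sub: "vec_nth ` F \<subseteq> B"
      unfolding B_def using * by (auto simp: PiE_def)
    have fB: "finite B" unfolding B_def by (rule finite_PiE) auto
    have "(\<Sum>k\<in>F. 1 / (weight k)\<^sup>2) = (\<Sum>g\<in>vec_nth ` F. \<Prod>i\<in>UNIV. q (g i))"
      by (subst sum.reindex) (auto simp: w inj_on_def vec_nth_inject)
    also have "\<dots> \<le> (\<Sum>g\<in>B. \<Prod>i\<in>UNIV. q (g i))"
      by (intro sum_mono2 fB sub prod_nonneg) (auto simp: q0)
    also have "\<dots> = (\<Prod>i\<in>(UNIV :: 'n set). sum q {-int N..int N})"
      unfolding B_def by (rule prod_sum_PiE[symmetric]) auto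
    also have "\<dots> \<le> (\<Prod>i\<in>(UNIV :: 'n set). 5)"
      using sum_inverse_square_le[of N] by (intro prod_mono) (auto simp: q_def intro!: sum_nonneg)
    finally show ?thesis by simp
  qed
  then show "bdd_above (sum (\<lambda>k :: int ^ 'n. 1 / (weight k)\<^sup>2) ` {F. F \<subseteq> UNIV \<and> finite F})"
    by (intro bdd_aboveI2) auto
qed

text \<open>
  Up to constants, \<open>weight\<close> lies between \<open>norm k\<close> and a power of \<open>1 + norm k\<close>, so these are the
  sequences of Schwartz type on the lattice.
\<close>

definition rapid :: "(int ^ 'n \<Rightarrow> complex) \<Rightarrow> bool" where
  "rapid c \<longleftrightarrow> (\<forall>p. \<exists>C. \<forall>k. norm (c k) * weight k ^ p \<le> C)"

lemma rapid_dominated: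
  assumes "rapid c" and le: "\<And>k. norm (c' k) \<le> B * weight k ^ q * norm (c k)"
  shows "rapid c'"
  unfolding rapid_def
proof
  fix p
  obtain C where C: "\<And>k. norm (c k) * weight k ^ (q + p) \<le> C"
    using assms(1) unfolding rapid_def by blast
  have "norm (c' k) * weight k ^ p \<le> \<bar>B\<bar> * C" for k
  proof -
    have "norm (c' k) * weight k ^ p \<le> (B * weight k ^ q * norm (c k)) * weight k ^ p"
      using le[of k] by (intro mult_right_mono) (auto intro: less_imp_le)
    also have "\<dots> = B * (norm (c k) * weight k ^ (q + p))" by (simp add: power_add)
    also have "\<dots> \<le> \<bar>B\<bar> * (norm (c k) * weight k ^ (q + p))"
      by (intro mult_right_mono) auto
    also have "\<dots> \<le> \<bar>B\<bar> * C" by (intro mult_left_mono C) auto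
    finally show ?thesis .
  qed
  then show "\<exists>C. \<forall>k. norm (c' k) * weight k ^ p \<le> C" by blast
qed

lemma rapid_weighted_summable:
  assumes "rapid c"
  shows "(\<lambda>k. norm (c k) * weight k ^ p) summable_on UNIV"
proof -
  obtain C where C: "\<And>k. norm (c k) * weight k ^ (p + 2) \<le> C"
    using assms unfolding rapid_def by blast
  have "norm (c k) * weight k ^ p \<le> C * (1 / (weight k)\<^sup>2)" for k
    using C[of k] weight_pos[of k] by (simp add: pos_le_divide_eq power_add power2_eq_square mult_ac del: weight_pos)
  then show ?thesis
    by (intro summable_on_comparison_test[OF summable_on_cmult_right[OF summable_inverse_weight_square, of C]])
       (auto intro: mult_nonneg_nonneg less_imp_le)
qed

lemma rapid_summable:
  assumes "rapid c"
  shows "(\<lambda>k. norm (c k)) summable_on UNIV"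
  using rapid_weighted_summable[OF assms, of 0] by simp

lemma rapid_finite_support:
  assumes "finite F" and "\<And>k. k \<notin> F \<Longrightarrow> c k = 0"
  shows "rapid c"
  unfolding rapid_def
proof
  fix p
  have "norm (c k) * weight k ^ p \<le> (\<Sum>k\<in>F. norm (c k) * weight k ^ p)" for k
  proof (cases "k \<in> F")
    case True
    then show ?thesis
      by (intro member_le_sum[where f = "\<lambda>k. norm (c k) * weight k ^ p"])
         (auto intro: assms)
  next
    case False
    then show ?thesis by (simp add: assms sum_nonneg)
  qed
  then show "\<exists>C. \<forall>k. norm (c k) * weight k ^ p \<le> C" by blast
qed

section \<open>Trigonometric series with rapidly decreasing coefficients\<close>

definition trig_series :: "(int ^ 'n \<Rightarrow> complex) \<Rightarrow> real ^ 'n \<Rightarrow> complex" where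
  "trig_series c x = (\<Sum>\<^sub>\<infinity>k. c k * torus_char k x)"

lemma trig_series_has_sum:
  assumes "(\<lambda>k. norm (c k)) summable_on UNIV"
  shows "((\<lambda>k. c k * torus_char k x) has_sum trig_series c x) UNIV"
  unfolding trig_series_def
  by (rule has_sum_infsum[OF abs_summable_summable]) (simp add: norm_mult assms)

lemma norm_trig_series_le:
  assumes "(\<lambda>k. norm (c k)) summable_on UNIV"
  shows "norm (trig_series c x) \<le> (\<Sum>\<^sub>\<infinity>k. norm (c k))"
proof -
  have "norm (trig_series c x) \<le> (\<Sum>\<^sub>\<infinity>k. norm (c k * torus_char k x))"
    unfolding trig_series_def by (rule norm_infsum_bound) (simp add: norm_mult assms)
  then show ?thesis by (simp add: norm_mult)
qed

text \<open>
  A remainder bounded by a fixed multiple of \<open>(norm y)\<^sup>2\<close> for all \<open>y\<close> can be summed over a family;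
  a mere limit statement for each summand could not.
\<close>

lemma has_derivative_quadratic:
  assumes D: "bounded_linear D" and bound: "\<And>y. norm (f (x + y) - f x - D y) \<le> C * (norm y)\<^sup>2"
  shows "(f has_derivative D) (at x)"
proof (rule has_derivativeI_sandwich[where e = 1 and H = "\<lambda>y. C * norm (y - x)"])
  show "norm (f y - f x - D (y - x)) / norm (y - x) \<le> C * norm (y - x)" if "y \<noteq> x" for y
    using bound[of "y - x"] that by (simp add: divide_le_eq power2_eq_square mult.assoc)
  show "((\<lambda>y. C * norm (y - x)) \<longlongrightarrow> 0) (at x)"
    by (rule tendsto_eq_intros refl | simp)+
qed (use D in auto)

lemma norm_cis_minus_linear_le: "norm (cis t - 1 - \<i> * of_real t) \<le> t\<^sup>2"
  using Taylor_exp[of "\<i> * of_real t" 1]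
  by (simp add: cis_conv_exp norm_mult power2_eq_square diff_diff_eq)

lemma abs_inner_of_int_vec_le:
  "\<bar>of_int_vec k \<bullet> (y :: real ^ 'n)\<bar> \<le> real CARD('n) * weight k * norm y"
proof -
  have "\<bar>of_int_vec k \<bullet> y\<bar> \<le> (\<Sum>i\<in>UNIV. \<bar>of_int (k $ i) * y $ i\<bar>)"
    unfolding inner_of_int_vec by (rule sum_abs)
  also have "\<dots> \<le> (\<Sum>i\<in>(UNIV :: 'n set). weight k * norm y)"
    by (intro sum_mono) (auto simp: abs_mult intro!: mult_mono abs_component_le_weight component_le_norm_cart)
  finally show ?thesis by simp
qed

text \<open>
  Each summand deviates from its linearisation by at most a multiple of
  \<open>norm (c k) * (weight k)\<^sup>2 * (norm y)\<^sup>2\<close>, and rapid decay makes these bounds summable in \<open>k\<close>.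
\<close>

lemma trig_series_has_derivative:
  fixes c :: "int ^ 'n \<Rightarrow> complex"
  assumes "rapid c"
  shows "(trig_series c has_derivative
    (\<lambda>y. \<Sum>i\<in>UNIV. of_real (y $ i) * trig_series (\<lambda>k. 2 * of_real pi * \<i> * of_int (k $ i) * c k) x)) (at x)"
proof (rule has_derivative_quadratic)
  let ?c' = "\<lambda>i k. 2 * of_real pi * \<i> * of_int (k $ i) * c k"
  let ?D = "\<lambda>y. \<Sum>i\<in>UNIV. of_real (y $ i) * trig_series (?c' i) x"
  show "bounded_linear ?D"
    by (intro bounded_linear_sum bounded_linear_mult_const
          bounded_linear_compose[OF bounded_linear_of_real bounded_linear_vec_nth])
  have rap: "rapid (?c' i)" for i
    by (rule rapid_dominated[OF assms, of _ "2 * pi" 1])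
       (auto simp: norm_mult intro!: mult_right_mono abs_component_le_weight)
  let ?K = "\<lambda>k. norm (c k) * weight k ^ 2"
  fix y :: "real ^ 'n"
  let ?C = "(2 * pi * real CARD('n))\<^sup>2"
  have D: "((\<lambda>k. \<Sum>i\<in>UNIV. of_real (y $ i) * (?c' i k * torus_char k x)) has_sum ?D y) UNIV"
    by (intro has_sum_finite_sum has_sum_cmult_right trig_series_has_sum rapid_summable rap)
  have inn: "(\<Sum>i\<in>UNIV. of_real (y $ i) * (?c' i k * torus_char k x)) =
     c k * torus_char k x * (\<i> * of_real (2 * pi * (of_int_vec k \<bullet> y)))" for k
    by (simp add: inner_of_int_vec sum_distrib_left mult_ac)
  have remainder: "((\<lambda>k. c k * torus_char k (x + y) - c k * torus_char k x
      - (\<Sum>i\<in>UNIV. of_real (y $ i) * (?c' i k * torus_char k x))) has_sum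
      (trig_series c (x + y) - trig_series c x - ?D y)) UNIV"
    by (intro has_sum_diff trig_series_has_sum rapid_summable assms D)
  have term_bound: "norm (c k * torus_char k (x + y) - c k * torus_char k x
      - (\<Sum>i\<in>UNIV. of_real (y $ i) * (?c' i k * torus_char k x))) \<le> ?C * (norm y)\<^sup>2 * ?K k" for k
  proof -
    have "c k * torus_char k (x + y) - c k * torus_char k x
      - (\<Sum>i\<in>UNIV. of_real (y $ i) * (?c' i k * torus_char k x))
      = c k * torus_char k x * (cis (2 * pi * (of_int_vec k \<bullet> y)) - 1 - \<i> * of_real (2 * pi * (of_int_vec k \<bullet> y)))"
      unfolding inn torus_char_arg_add by (simp add: torus_char_def[of k y] algebra_simps)
    then have "norm (c k * torus_char k (x + y) - c k * torus_char k x
      - (\<Sum>i\<in>UNIV. of_real (y $ i) * (?c' i k * torus_char k x)))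
      = norm (c k) * norm (cis (2 * pi * (of_int_vec k \<bullet> y)) - 1 - \<i> * of_real (2 * pi * (of_int_vec k \<bullet> y)))"
      by (simp only: norm_mult norm_torus_char mult_1_right)
    also have "\<dots> \<le> norm (c k) * (2 * pi * (of_int_vec k \<bullet> y))\<^sup>2"
      by (intro mult_left_mono norm_cis_minus_linear_le norm_ge_zero)
    also have "(2 * pi * (of_int_vec k \<bullet> y))\<^sup>2 \<le> (2 * pi * (real CARD('n) * weight k * norm y))\<^sup>2"
      unfolding power_mult_distrib[of "2 * pi"]
      by (intro mult_left_mono iffD1[OF abs_le_square_iff] order.trans[OF abs_inner_of_int_vec_le]) auto
    then have "norm (c k) * (2 * pi * (of_int_vec k \<bullet> y))\<^sup>2
        \<le> norm (c k) * (2 * pi * (real CARD('n) * weight k * norm y))\<^sup>2"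
      by (intro mult_left_mono norm_ge_zero)
    also have "\<dots> = ?C * (norm y)\<^sup>2 * ?K k" by (simp add: power_mult_distrib)
    finally show ?thesis .
  qed
  have "norm (trig_series c (x + y) - trig_series c x - ?D y) \<le> infsum (\<lambda>k. ?C * (norm y)\<^sup>2 * ?K k) UNIV"
    by (rule norm_infsum_le[OF remainder has_sum_infsum term_bound])
       (rule summable_on_cmult_right rapid_weighted_summable assms)+
  also have "\<dots> = (?C * (norm y)\<^sup>2) * infsum ?K UNIV"
    by (rule infsum_cmult_right')
  also have "\<dots> = ?C * infsum ?K UNIV * (norm y)\<^sup>2" by simp
  finally show "norm (trig_series c (x + y) - trig_series c x - ?D y) \<le> ?C * infsum ?K UNIV * (norm y)\<^sup>2" .
qed

definition deriv_symbol :: "'n list \<Rightarrow> int ^ 'n \<Rightarrow> complex" where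
  "deriv_symbol is k = (\<Prod>i\<leftarrow>is. 2 * of_real pi * \<i> * of_int (k $ i))"

lemma norm_deriv_symbol_le:
  "norm (deriv_symbol is k) \<le> (2 * pi) ^ length is * weight k ^ length is"
proof (induction "is")
  case (Cons i "is")
  have "norm (deriv_symbol (i # is) k) = (2 * pi * \<bar>of_int (k $ i)\<bar>) * norm (deriv_symbol is k)"
    by (simp add: deriv_symbol_def norm_mult)
  also have "\<dots> \<le> (2 * pi * weight k) * ((2 * pi) ^ length is * weight k ^ length is)"
    by (intro mult_mono Cons.IH mult_left_mono abs_component_le_weight) (auto intro: less_imp_le)
  finally show ?case by (simp add: mult_ac)
qed (simp add: deriv_symbol_def)

lemma rapid_deriv_symbol:
  "rapid c \<Longrightarrow> rapid (\<lambda>k. deriv_symbol is k * c k)"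
  by (erule rapid_dominated[where B = "(2 * pi) ^ length is" and q = "length is"])
     (simp only: norm_mult mult_right_mono[OF norm_deriv_symbol_le] norm_ge_zero)

lemma iter_partial_trig_series:
  fixes c :: "int ^ 'n \<Rightarrow> complex"
  assumes "rapid c"
  shows "iter_partial is (trig_series c) = trig_series (\<lambda>k. deriv_symbol is k * c k)"
proof (induction "is")
  case (Cons i "is")
  let ?b = "\<lambda>k. deriv_symbol is k * c k"
  have "partial_deriv i (trig_series ?b) x = trig_series (\<lambda>k. 2 * of_real pi * \<i> * of_int (k $ i) * ?b k) x" for x
  proof -
    have "partial_deriv i (trig_series ?b) x
      = (\<Sum>j\<in>UNIV. of_real (axis i 1 $ j) * trig_series (\<lambda>k. 2 * of_real pi * \<i> * of_int (k $ j) * ?b k) x)"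
      unfolding partial_deriv_def
      by (subst frechet_derivative_at[OF trig_series_has_derivative[OF rapid_deriv_symbol[OF assms]], symmetric]) simp
    also have "\<dots> = (\<Sum>j\<in>UNIV. if j = i then trig_series (\<lambda>k. 2 * of_real pi * \<i> * of_int (k $ j) * ?b k) x else 0)"
      by (intro sum.cong refl) (simp add: axis_def)
    also have "\<dots> = trig_series (\<lambda>k. 2 * of_real pi * \<i> * of_int (k $ i) * ?b k) x"
      by (simp only: sum.delta finite UNIV_I if_True)
    finally show ?thesis .
  qed
  moreover have "(\<lambda>k. 2 * of_real pi * \<i> * of_int (k $ i) * ?b k) = (\<lambda>k. deriv_symbol (i # is) k * c k)"
    by (simp add: deriv_symbol_def mult.assoc)
  ultimately have "partial_deriv i (trig_series ?b) x = trig_series (\<lambda>k. deriv_symbol (i # is) k * c k) x" for x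
    by (simp only:)
  then have "partial_deriv i (trig_series ?b) = trig_series (\<lambda>k. deriv_symbol (i # is) k * c k)"
    by (rule ext)
  moreover have "iter_partial (i # is) (trig_series c) = partial_deriv i (iter_partial is (trig_series c))"
    by (simp add: iter_partial_def)
  ultimately show ?case by (simp only: Cons.IH)
qed (simp add: iter_partial_def deriv_symbol_def)

lemma trig_series_test_function:
  assumes "rapid c"
  shows "trig_series c \<in> test_functions"
proof -
  have "iter_partial is (trig_series c) differentiable (at x)" for "is" x
    unfolding iter_partial_trig_series[OF assms] differentiable_def
    using trig_series_has_derivative[OF rapid_deriv_symbol[OF assms]] by blast
  then show ?thesis
    by (auto simp: test_functions_def smooth_def periodic_def trig_series_def torus_char_arg_add)
qed

section \<open>Fourier coefficients of test functions\<close>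

lemma test_function_has_derivative:
  assumes "h \<in> test_functions"
  shows "(h has_derivative frechet_derivative h (at x)) (at x)"
proof -
  have "iter_partial [] h differentiable (at x)"
    using assms unfolding test_functions_def smooth_def by blast
  then show ?thesis by (simp add: iter_partial_def frechet_derivative_works)
qed

lemma test_function_continuous:
  assumes "h \<in> test_functions"
  shows "continuous_on S h"
  using test_function_has_derivative[OF assms] has_derivative_continuous
  by (blast intro: continuous_at_imp_continuous_on)

lemma test_function_periodic: "h \<in> test_functions \<Longrightarrow> periodic h"
  by (simp add: test_functions_def)

lemma periodic_partial_deriv:
  fixes g :: "real ^ 'n \<Rightarrow> complex"
  assumes "periodic g" and "\<And>x. g differentiable (at x)"
  shows "periodic (partial_deriv i g)"
  unfolding periodic_def
proof (intro allI)
  fix x :: "real ^ 'n" and m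
  let ?D = "frechet_derivative g (at (x + of_int_vec m))"
  have "((\<lambda>y. g (y + of_int_vec m)) has_derivative (\<lambda>y. ?D y)) (at x)"
    by (rule has_derivative_compose[of "\<lambda>y. y + of_int_vec m" "\<lambda>y. y" x UNIV g, simplified])
       (use assms(2) frechet_derivative_works in \<open>auto intro!: derivative_eq_intros\<close>)
  moreover have "(\<lambda>y. g (y + of_int_vec m)) = g" using assms(1) by (auto simp: periodic_def)
  ultimately have "?D = frechet_derivative g (at x)" using frechet_derivative_at by metis
  then show "partial_deriv i g (x + of_int_vec m) = partial_deriv i g x"
    by (simp add: partial_deriv_def)
qed

lemma iter_partial_test_function:
  assumes "h \<in> test_functions"
  shows "iter_partial is h \<in> test_functions"
proof (induction "is")
  case Nil
  then show ?case using assms by (simp add: iter_partial_def)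
next
  case (Cons i "is")
  let ?g = "iter_partial is h"
  have "iter_partial js (partial_deriv i ?g) = iter_partial (js @ [i]) ?g" for js
    by (simp add: iter_partial_def)
  moreover have "periodic (partial_deriv i ?g)"
    using Cons test_function_has_derivative[OF Cons]
    by (intro periodic_partial_deriv) (auto simp: test_function_periodic differentiable_def)
  ultimately have "partial_deriv i ?g \<in> test_functions"
    using Cons by (simp add: test_functions_def smooth_def)
  then show ?case by (simp add: iter_partial_def)
qed

lemma axis_eq_of_int_vec: "(axis i 1 :: real ^ 'n) = of_int_vec (axis i 1)"
  by (simp add: vec_eq_iff of_int_vec_def axis_def)

text \<open>
  The unit cube and its translate along an axis overlap in a box, and the two slabs left over
  differ by a lattice vector.
\<close>

lemma integral_periodic_translate:
  fixes g :: "real ^ 'n \<Rightarrow> complex"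
  assumes per: "periodic g" and cont: "continuous_on UNIV g" and s: "0 \<le> s" "s \<le> 1"
  shows "integral (cbox 0 1) (\<lambda>x. g (x + s *\<^sub>R axis i 1)) = integral (cbox 0 1) g"
proof -
  define e :: "real ^ 'n" where "e = axis i 1"
  define L where "L = cbox 0 ((\<chi> j. if j = i then s else 1) :: real ^ 'n)"
  define R where "R = cbox (s *\<^sub>R e) (1 :: real ^ 'n)"
  have e: "e \<in> Basis" "\<And>x :: real ^ 'n. x \<bullet> e = x $ i"
    by (auto simp: e_def axis_in_Basis_iff inner_axis)
  have int: "g integrable_on cbox a b" for a b
    by (rule integrable_continuous) (rule continuous_on_subset[OF cont], simp)
  have "integral (cbox 0 1) g = integral (cbox 0 1 \<inter> {x. x \<bullet> e \<le> s}) g + integral (cbox 0 1 \<inter> {x. s \<le> x \<bullet> e}) g"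
    by (rule integral_split[OF int e(1)])
  also have "cbox 0 1 \<inter> {x. x \<bullet> e \<le> s} = L"
    unfolding L_def using s by (auto simp: e(2) mem_box_cart split: if_splits) (smt (verit))+
  also have "cbox 0 1 \<inter> {x. s \<le> x \<bullet> e} = R"
    unfolding R_def e(2) using s by (auto simp: mem_box_cart e_def axis_def split: if_splits) (smt (verit))+
  finally have whole: "integral (cbox 0 1) g = integral L g + integral R g" .
  have L_shift: "integral L g = integral (cbox e (1 + s *\<^sub>R e)) g"
  proof -
    have "L = cbox (e - e) ((1 + s *\<^sub>R e) - e)"
      unfolding L_def by (rule arg_cong2[of _ _ _ _ cbox]) (auto simp: e_def axis_def vec_eq_iff)
    moreover have "(\<lambda>x. g (x + e)) = g"
      using per by (simp add: e_def axis_eq_of_int_vec periodic_def fun_eq_iff)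
    ultimately show ?thesis using integral_shift_cbox[of e e "1 + s *\<^sub>R e" g] by simp
  qed
  have "integral (cbox 0 1) (\<lambda>x. g (x + s *\<^sub>R e)) = integral (cbox (s *\<^sub>R e) (1 + s *\<^sub>R e)) g"
    using integral_shift_cbox[of "s *\<^sub>R e" "s *\<^sub>R e" "1 + s *\<^sub>R e" g] by simp
  also have "\<dots> = integral (cbox (s *\<^sub>R e) (1 + s *\<^sub>R e) \<inter> {x. x \<bullet> e \<le> 1}) g
      + integral (cbox (s *\<^sub>R e) (1 + s *\<^sub>R e) \<inter> {x. 1 \<le> x \<bullet> e}) g"
    by (rule integral_split[OF int e(1)])
  also have "cbox (s *\<^sub>R e) (1 + s *\<^sub>R e) \<inter> {x. x \<bullet> e \<le> 1} = R"
    unfolding R_def e(2) using s by (auto simp: mem_box_cart e_def axis_def split: if_splits) (smt (verit))+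
  also have "cbox (s *\<^sub>R e) (1 + s *\<^sub>R e) \<inter> {x. 1 \<le> x \<bullet> e} = cbox e (1 + s *\<^sub>R e)"
    unfolding e(2) using s by (auto simp: mem_box_cart e_def axis_def split: if_splits) (smt (verit))+
  finally show ?thesis using whole L_shift by (simp add: e_def)
qed

text \<open>
  The integral of a translate of \<open>g\<close> along the \<open>i\<close>-th axis is constant in the translation parameter;
  the claim is the vanishing of its derivative at \<open>0\<close>. Applied to \<open>h\<close> times a character, this is
  integration by parts on the torus, and applied to a character it is orthogonality.
\<close>

lemma integral_partial_deriv_periodic:
  fixes g :: "real ^ 'n \<Rightarrow> complex"
  assumes per: "periodic g" and diff: "\<And>x. g differentiable (at x)"
    and cont: "continuous_on UNIV (partial_deriv i g)"
  shows "integral (cbox 0 1) (partial_deriv i g) = 0"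
proof -
  define e :: "real ^ 'n" where "e = axis i 1"
  have cg: "continuous_on UNIV g"
    using diff by (meson continuous_at_imp_continuous_on differentiable_imp_continuous_within)
  define F where "F s = integral (cbox 0 1) (\<lambda>x. g (x + s *\<^sub>R e))" for s
  have "(F has_vector_derivative integral (cbox 0 1) (\<lambda>x. partial_deriv i g (x + 0 *\<^sub>R e))) (at 0 within cbox 0 1)"
    unfolding F_def
  proof (rule leibniz_rule_vector_derivative)
    fix s :: real and x :: "real ^ 'n"
    let ?D = "frechet_derivative g (at (x + s *\<^sub>R e))"
    have D: "(g has_derivative ?D) (at (x + s *\<^sub>R e))" using diff frechet_derivative_works by blast
    have "((\<lambda>s. g (x + s *\<^sub>R e)) has_derivative (\<lambda>t. ?D (t *\<^sub>R e))) (at s within cbox 0 1)"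
      by (rule has_derivative_compose[where g = g and f = "\<lambda>s. x + s *\<^sub>R e", OF _ D])
         (auto intro!: derivative_eq_intros)
    moreover have "(\<lambda>t. ?D (t *\<^sub>R e)) = (\<lambda>t. t *\<^sub>R partial_deriv i g (x + s *\<^sub>R e))"
      using linear_scale[OF has_derivative_linear[OF D]] by (simp add: partial_deriv_def e_def)
    ultimately show "((\<lambda>s. g (x + s *\<^sub>R e)) has_vector_derivative partial_deriv i g (x + s *\<^sub>R e)) (at s within cbox 0 1)"
      by (simp add: has_vector_derivative_def)
  next
    show "(\<lambda>x. g (x + s *\<^sub>R e)) integrable_on cbox 0 1" for s
      by (intro integrable_continuous continuous_on_compose2[OF cg] continuous_intros) auto
    show "continuous_on (cbox 0 1 \<times> cbox 0 1) (\<lambda>(s, x). partial_deriv i g (x + s *\<^sub>R e))"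
      unfolding case_prod_unfold by (intro continuous_on_compose2[OF cont] continuous_intros) auto
  qed auto
  moreover have "(F has_vector_derivative 0) (at 0 within cbox 0 1)"
    by (rule has_vector_derivative_transform[where f = "\<lambda>_. integral (cbox 0 1) g"])
       (auto simp: F_def e_def integral_periodic_translate[OF per cg])
  ultimately have "integral (cbox 0 1) (\<lambda>x. partial_deriv i g (x + 0 *\<^sub>R e)) = 0"
    by (rule vector_derivative_unique_within_closed_interval[of 0 1 0, rotated 2]) auto
  then show ?thesis by simp
qed

lemma torus_char_eq_trig_series: "torus_char k = trig_series (\<lambda>l. if l = k then 1 else 0)"
proof
  fix x
  have "((\<lambda>l. (if l = k then 1 else 0) * torus_char l x) has_sum torus_char k x) UNIV"
    by (rule has_sum_finite_neutralI[of "{k}"]) auto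
  then show "torus_char k x = trig_series (\<lambda>l. if l = k then 1 else 0) x"
    unfolding trig_series_def by (metis infsumI)
qed

lemma torus_char_test_function: "torus_char k \<in> test_functions"
  unfolding torus_char_eq_trig_series
  by (intro trig_series_test_function rapid_finite_support[of "{k}"]) auto

lemma torus_char_has_derivative:
  "(torus_char k has_derivative (\<lambda>y. 2 * of_real pi * \<i> * of_real (of_int_vec k \<bullet> y) * torus_char k x)) (at x)"
proof (rule has_derivative_quadratic)
  show "bounded_linear (\<lambda>y. 2 * of_real pi * \<i> * of_real (of_int_vec k \<bullet> y) * torus_char k x)"
    by (intro bounded_linear_mult_const bounded_linear_const_mult
          bounded_linear_compose[OF bounded_linear_of_real bounded_linear_inner_right])
  fix y
  have "norm (torus_char k (x + y) - torus_char k x - 2 * of_real pi * \<i> * of_real (of_int_vec k \<bullet> y) * torus_char k x)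
    = norm (torus_char k x * (cis (2 * pi * (of_int_vec k \<bullet> y)) - 1 - \<i> * of_real (2 * pi * (of_int_vec k \<bullet> y))))"
    unfolding torus_char_arg_add by (simp add: torus_char_def[of k y] algebra_simps)
  also have "\<dots> \<le> (2 * pi * (of_int_vec k \<bullet> y))\<^sup>2"
    by (simp only: norm_mult norm_torus_char mult_1_left norm_cis_minus_linear_le)
  also have "\<dots> \<le> (2 * pi * norm (of_int_vec k :: real ^ 'a))\<^sup>2 * (norm y)\<^sup>2"
    unfolding power_mult_distrib mult.assoc
    by (intro mult_left_mono) (auto simp: Cauchy_Schwarz_ineq power2_norm_eq_inner)
  finally show "norm (torus_char k (x + y) - torus_char k x - 2 * of_real pi * \<i> * of_real (of_int_vec k \<bullet> y) * torus_char k x)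
    \<le> (2 * pi * norm (of_int_vec k :: real ^ 'a))\<^sup>2 * (norm y)\<^sup>2" .
qed

lemma inner_of_int_vec_axis: "of_int_vec k \<bullet> (axis i 1 :: real ^ 'n) = of_int (k $ i)"
  by (simp add: inner_axis of_int_vec_def)

lemma partial_deriv_torus_char:
  "partial_deriv i (torus_char k) x = 2 * of_real pi * \<i> * of_int (k $ i) * torus_char k x"
  unfolding partial_deriv_def
  by (subst frechet_derivative_at[OF torus_char_has_derivative, symmetric])
     (simp add: inner_of_int_vec_axis)

lemma integral_torus_char:
  "integral (cbox 0 1) (torus_char k) = (if k = 0 then 1 else 0)"
proof (cases "k = 0")
  case True
  have "torus_char k = (\<lambda>x. 1)" by (simp add: True fun_eq_iff)
  then show ?thesis using True by (simp add: content_cbox_cart interval_eq_empty_cart)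
next
  case False
  then obtain i where i: "k $ i \<noteq> 0" by (auto simp: vec_eq_iff)
  have eq: "partial_deriv i (torus_char k) = (\<lambda>x. 2 * of_real pi * \<i> * of_int (k $ i) * torus_char k x)"
    by (rule ext) (rule partial_deriv_torus_char)
  have "integral (cbox 0 1) (partial_deriv i (torus_char k)) = 0"
  proof (rule integral_partial_deriv_periodic)
    show "periodic (torus_char k)" by (rule test_function_periodic[OF torus_char_test_function])
    show "torus_char k differentiable at x" for x
      using torus_char_has_derivative differentiable_def by blast
    show "continuous_on UNIV (partial_deriv i (torus_char k))"
      unfolding eq by (intro continuous_intros)
  qed
  then have "2 * of_real pi * \<i> * of_int (k $ i) * integral (cbox 0 1) (torus_char k) = 0"
    by (simp only: eq integral_mult_right)
  then show ?thesis using i False by simp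
qed

abbreviation torus_coeff :: "(real ^ 'n \<Rightarrow> complex) \<Rightarrow> int ^ 'n \<Rightarrow> complex" where
  "torus_coeff h \<equiv> fourier_coeff (dist_of_fun h)"

lemma torus_coeff_eq_integral:
  assumes "continuous_on UNIV h"
  shows "torus_coeff h k = integral (cbox 0 1) (\<lambda>x. h x * torus_char (- k) x)"
  unfolding fourier_coeff_eq dist_of_fun_def
proof (rule set_borel_integral_eq_integral)
  have "continuous_on (cbox 0 1) (\<lambda>x. h x * torus_char (- k) x)"
    by (intro continuous_intros continuous_on_subset[OF assms]) auto
  then show "set_integrable lborel (cbox 0 1) (\<lambda>x. h x * torus_char (- k) x)"
    unfolding set_integrable_def by (intro borel_integrable_compact) auto
qed

lemma integrable_times_torus_char:
  assumes "continuous_on UNIV h"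
  shows "(\<lambda>x. h x * torus_char k x) integrable_on cbox a b"
  by (intro integrable_continuous continuous_intros continuous_on_subset[OF assms]) auto

lemma norm_torus_coeff_le:
  assumes cont: "continuous_on UNIV h" and bound: "\<And>x. norm (h x) \<le> B"
  shows "norm (torus_coeff h k) \<le> B"
proof -
  have B: "0 \<le> B" using order.trans[OF norm_ge_zero bound] .
  have "norm (torus_coeff h k) \<le> B * measure lborel (cbox (0 :: real ^ 'a) 1)"
    unfolding torus_coeff_eq_integral[OF cont]
    by (rule has_integral_bound[OF B integrable_integral[OF integrable_times_torus_char[OF cont]]])
       (simp add: norm_mult bound)
  then show ?thesis by (simp add: content_cbox_cart interval_eq_empty_cart)
qed

lemma translate_into_unit_cube:
  obtains m where "x + of_int_vec m \<in> cbox (0 :: real ^ 'n) 1"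
proof
  show "x + of_int_vec (\<chi> i. - \<lfloor>x $ i\<rfloor>) \<in> cbox 0 1"
    by (auto simp: mem_box_cart of_int_vec_def) linarith
qed

lemma test_function_bounded:
  assumes "h \<in> test_functions"
  obtains B where "\<And>x. norm (h x) \<le> B"
proof -
  have "bounded (h ` cbox 0 1)"
    by (intro compact_imp_bounded compact_continuous_image test_function_continuous assms compact_cbox)
  then obtain B where B: "\<And>x. x \<in> cbox 0 1 \<Longrightarrow> norm (h x) \<le> B"
    by (auto simp: bounded_iff)
  have "norm (h x) \<le> B" for x
  proof -
    obtain m where "x + of_int_vec m \<in> cbox 0 1" by (rule translate_into_unit_cube)
    from B[OF this] show ?thesis using test_function_periodic[OF assms] by (simp add: periodic_def)
  qed
  then show ?thesis by (rule that)
qed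

lemma torus_coeff_partial_deriv:
  assumes h: "h \<in> test_functions"
  shows "torus_coeff (partial_deriv i h) k = 2 * of_real pi * \<i> * of_int (k $ i) * torus_coeff h k"
proof -
  let ?g = "\<lambda>x. h x * torus_char (- k) x"
  have dh: "partial_deriv i h \<in> test_functions"
    using iter_partial_test_function[OF h, of "[i]"] by (simp add: iter_partial_def)
  have D: "(?g has_derivative (\<lambda>y. h x * (2 * of_real pi * \<i> * of_real (of_int_vec (- k) \<bullet> y) * torus_char (- k) x)
        + frechet_derivative h (at x) y * torus_char (- k) x)) (at x)" for x
    by (rule has_derivative_mult[OF test_function_has_derivative[OF h] torus_char_has_derivative])
  have eq: "partial_deriv i ?g = (\<lambda>x. partial_deriv i h x * torus_char (- k) x
      - 2 * of_real pi * \<i> * of_int (k $ i) * ?g x)"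
    unfolding fun_eq_iff partial_deriv_def
    by (subst frechet_derivative_at[OF D, symmetric])
       (simp add: inner_of_int_vec_axis of_int_vec_simps(3)[symmetric] del: of_int_vec_simps)
  have "integral (cbox 0 1) (partial_deriv i ?g) = 0"
  proof (rule integral_partial_deriv_periodic)
    show "periodic ?g"
      using test_function_periodic[OF h] test_function_periodic[OF torus_char_test_function, of "- k"]
      by (simp add: periodic_def)
    show "?g differentiable at x" for x using D differentiable_def by blast
    show "continuous_on UNIV (partial_deriv i ?g)"
      unfolding eq by (intro continuous_intros test_function_continuous h dh)
  qed
  then have "0 = integral (cbox 0 1) (\<lambda>x. partial_deriv i h x * torus_char (- k) x)
      - 2 * of_real pi * \<i> * of_int (k $ i) * integral (cbox 0 1) ?g"
    unfolding eq
    by (subst (asm) integral_diff)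
       (auto intro!: integrable_times_torus_char test_function_continuous h dh integrable_on_mult_right)
  then show ?thesis
    by (simp add: torus_coeff_eq_integral test_function_continuous h dh)
qed

lemma torus_coeff_iter_partial:
  assumes "h \<in> test_functions"
  shows "torus_coeff (iter_partial is h) k = deriv_symbol is k * torus_coeff h k"
proof (induction "is")
  case (Cons i "is")
  have "iter_partial (i # is) h = partial_deriv i (iter_partial is h)"
    by (simp add: iter_partial_def)
  then show ?case
    by (simp add: torus_coeff_partial_deriv[OF iter_partial_test_function[OF assms]] Cons.IH
        deriv_symbol_def)
qed (simp add: iter_partial_def deriv_symbol_def)

text \<open>
  Differentiating \<open>p\<close> times in each direction \<open>i\<close> with \<open>k $ i \<noteq> 0\<close> multiplies the coefficient at
  \<open>k\<close> by a number of modulus at least \<open>weight k ^ p\<close>. The differential operator depends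
  on \<open>k\<close> only through the set of these directions, hence there are finitely many operators
  and one bound serves for all \<open>k\<close>.
\<close>

lemma rapid_torus_coeff:
  fixes h :: "real ^ 'n \<Rightarrow> complex"
  assumes h: "h \<in> test_functions"
  shows "rapid (torus_coeff h)"
  unfolding rapid_def
proof
  fix p
  define supp where "supp k = {i. k $ i \<noteq> 0}" for k :: "int ^ 'n"
  have "\<exists>xs. set xs = I \<and> distinct xs" for I :: "'n set"
    using finite_distinct_list[of I] by auto
  then obtain xs where xs: "set (xs I) = I" "distinct (xs I)" for I :: "'n set" by metis
  define ds where "ds I = concat (replicate p (xs I))" for I
  have "\<exists>C. \<forall>k. norm (deriv_symbol is k * torus_coeff h k) \<le> C" for "is"
  proof -
    obtain B where B: "\<And>x. norm (iter_partial is h x) \<le> B"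
      using test_function_bounded[OF iter_partial_test_function[OF h]] by blast
    show ?thesis
      using norm_torus_coeff_le[OF test_function_continuous[OF iter_partial_test_function[OF h]] B]
      unfolding torus_coeff_iter_partial[OF h] by blast
  qed
  then obtain C where C: "\<And>is k. norm (deriv_symbol is k * torus_coeff h k) \<le> C is" by metis
  have "norm (torus_coeff h k) * weight k ^ p \<le> (\<Sum>I\<in>UNIV. C (ds I))" for k
  proof -
    let ?I = "supp k"
    have "deriv_symbol (concat (replicate q ys)) k = deriv_symbol ys k ^ q" for q ys
      by (induction q) (simp_all add: deriv_symbol_def)
    then have pw: "deriv_symbol (ds ?I) k = deriv_symbol (xs ?I) k ^ p"
      by (simp add: ds_def)
    have "norm (deriv_symbol (xs ?I) k) = (\<Prod>i\<leftarrow>xs ?I. norm (2 * of_real pi * \<i> * of_int (k $ i) :: complex))"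
    proof -
      have "norm (\<Prod>i\<leftarrow>ys. f i) = (\<Prod>i\<leftarrow>ys. norm (f i))" for ys and f :: "'n \<Rightarrow> complex"
        by (induction ys) (simp_all add: norm_mult)
      then show ?thesis unfolding deriv_symbol_def .
    qed
    also have "\<dots> = (\<Prod>i\<in>?I. 2 * pi * real_of_int \<bar>k $ i\<bar>)"
      by (subst prod.distinct_set_conv_list[OF xs(2), of _ ?I, symmetric]) (simp add: xs norm_mult)
    also have "\<dots> \<ge> (\<Prod>i\<in>?I. max 1 (real_of_int \<bar>k $ i\<bar>))"
    proof (intro prod_mono conjI)
      fix i assume "i \<in> ?I"
      then have "1 \<le> real_of_int \<bar>k $ i\<bar>" by (simp add: supp_def)
      moreover have "1 \<le> 2 * pi" using pi_ge_two by linarith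
      ultimately show "max 1 (real_of_int \<bar>k $ i\<bar>) \<le> 2 * pi * real_of_int \<bar>k $ i\<bar>"
        using mult_right_mono[of 1 "2 * pi" "real_of_int \<bar>k $ i\<bar>"] by simp
    qed simp
    also have "(\<Prod>i\<in>?I. max 1 (real_of_int \<bar>k $ i\<bar>)) = weight k"
      unfolding weight_def by (rule prod.mono_neutral_left) (auto simp: supp_def)
    finally have "weight k ^ p \<le> norm (deriv_symbol (ds ?I) k)"
      unfolding pw norm_power by (intro power_mono) auto
    then have "norm (torus_coeff h k) * weight k ^ p \<le> norm (deriv_symbol (ds ?I) k * torus_coeff h k)"
      by (simp add: norm_mult mult_right_mono mult.commute[of "norm (torus_coeff h k)"])
    also have "\<dots> \<le> C (ds ?I)" by (rule C)
    also have "\<dots> \<le> (\<Sum>I\<in>UNIV. C (ds I))"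
      by (rule member_le_sum) (auto intro: order.trans[OF norm_ge_zero C])
    finally show ?thesis .
  qed
  then show "\<exists>C. \<forall>k. norm (torus_coeff h k) * weight k ^ p \<le> C" by blast
qed

section \<open>Uniqueness of Fourier coefficients\<close>

inductive trig_poly :: "(real ^ 'n \<Rightarrow> complex) \<Rightarrow> bool" where
  char: "trig_poly (torus_char k)"
| scale: "trig_poly p \<Longrightarrow> trig_poly (\<lambda>x. c * p x)"
| add: "trig_poly p \<Longrightarrow> trig_poly q \<Longrightarrow> trig_poly (\<lambda>x. p x + q x)"

lemma trig_poly_char_mult: "trig_poly q \<Longrightarrow> trig_poly (\<lambda>x. torus_char k x * q x)"
proof (induction q rule: trig_poly.induct)
  case (char l)
  show ?case unfolding torus_char_add[symmetric] by (rule trig_poly.char)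
next
  case (scale p c)
  then show ?case using trig_poly.scale[OF scale.IH, of c] by (simp add: mult.left_commute)
next
  case (add p q)
  then show ?case using trig_poly.add[OF add.IH] by (simp add: distrib_left)
qed

lemma trig_poly_mult: "trig_poly p \<Longrightarrow> trig_poly q \<Longrightarrow> trig_poly (\<lambda>x. p x * q x)"
proof (induction p rule: trig_poly.induct)
  case (char l)
  then show ?case by (rule trig_poly_char_mult)
next
  case (scale p c)
  then show ?case using trig_poly.scale[OF scale.IH, of c] by (simp add: mult.assoc)
next
  case (add p q)
  then show ?case using trig_poly.add[OF add.IH] by (simp add: distrib_right)
qed

lemma trig_poly_const: "trig_poly (\<lambda>x. c)"
  using trig_poly.scale[OF trig_poly.char[of 0], of c] by simp

lemma trig_poly_sum:
  "(\<And>i. i \<in> I \<Longrightarrow> trig_poly (p i)) \<Longrightarrow> trig_poly (\<lambda>x. \<Sum>i\<in>I. p i x)"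
  by (induction I rule: infinite_finite_induct) (simp_all add: trig_poly_const trig_poly.add)

text \<open>
  Lattice translates cannot be separated by periodic functions, so the Stone-Weierstrass theorem has
  no direct use on \<open>\<real>\<^sup>n\<close>. It applies on the image of the torus in \<open>\<complex>\<^sup>n\<close>, where real polynomials
  pull back to trigonometric polynomials.
\<close>

definition torus_embed :: "real ^ 'n \<Rightarrow> complex ^ 'n" where
  "torus_embed x = (\<chi> i. torus_char (axis i 1) x)"

lemma continuous_torus_embed: "continuous_on S torus_embed"
  unfolding torus_embed_def by (intro continuous_intros)

lemma torus_embed_periodic: "torus_embed (x + of_int_vec m) = torus_embed x"
  by (simp add: torus_embed_def torus_char_arg_add)

lemma torus_embed_eqD:
  assumes "torus_embed x = torus_embed (y :: real ^ 'n)"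
  obtains m where "x = y + of_int_vec m"
proof -
  have comp: "torus_char (axis i 1) z = cis (2 * pi * z $ i)" for i and z :: "real ^ 'n"
    by (simp add: torus_char_def axis_eq_of_int_vec[symmetric] inner_axis')
  have "\<exists>j::int. x $ i = y $ i + of_int j" for i
  proof -
    have "torus_embed x $ i = torus_embed y $ i" using assms by simp
    then have "cis (2 * pi * x $ i) = cis (2 * pi * y $ i)" by (simp add: torus_embed_def comp)
    then obtain j :: int where "2 * pi * x $ i = 2 * pi * y $ i + 2 * pi * of_int j"
      using sin_cos_eq_iff[of "2 * pi * x $ i" "2 * pi * y $ i"] by (auto simp: complex_eq_iff)
    then have "2 * pi * x $ i = 2 * pi * (y $ i + of_int j)" by (simp add: algebra_simps)
    then have "x $ i = y $ i + of_int j" by simp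
    then show ?thesis ..
  qed
  then obtain m where "\<And>i. x $ i = y $ i + of_int (m i)" by metis
  then have "x = y + of_int_vec (\<chi> i. m i)" by (simp add: vec_eq_iff of_int_vec_def)
  then show ?thesis by (rule that)
qed

text \<open>
  Real and imaginary parts of a coordinate \<open>z\<close> of the embedding are combinations of \<open>z\<close> and
  \<open>cnj z\<close>, and both are characters.
\<close>

lemma trig_poly_real_polynomial:
  assumes "real_polynomial_function p"
  shows "trig_poly (\<lambda>x. of_real (p (torus_embed x)))"
  using assms
proof (induction p rule: real_polynomial_function.induct)
  case (linear f)
  have expand: "f z = (\<Sum>i\<in>UNIV. Re (z $ i) * f (axis i 1) + Im (z $ i) * f (axis i \<i>))" for z :: "complex ^ 'a"
  proof -
    have "z = (\<Sum>i\<in>UNIV. Re (z $ i) *\<^sub>R axis i 1 + Im (z $ i) *\<^sub>R axis i \<i>)"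
      by (simp add: vec_eq_iff axis_def complex_eq_iff if_distrib[of Re] if_distrib[of Im] sum.distrib
           if_distrib[of "\<lambda>x. _ * x"] cong: if_cong)
    then have "f z = f (\<Sum>i\<in>UNIV. Re (z $ i) *\<^sub>R axis i 1 + Im (z $ i) *\<^sub>R axis i \<i>)" by simp
    then show ?thesis
      using bounded_linear.linear[OF linear] by (simp add: linear_sum linear_add linear_scale)
  qed
  have real_part: "of_real (Re z * a + Im z * b)
      = of_real (a / 2) * (z + cnj z) + of_real (b / 2) * (- \<i>) * (z + (- 1) * cnj z)" for z a b
    by (simp add: complex_eq_iff)
  have "of_real (f (torus_embed x)) = (\<Sum>i\<in>UNIV.
      of_real (f (axis i 1) / 2) * (torus_char (axis i 1) x + torus_char (- axis i 1) x)
      + of_real (f (axis i \<i>) / 2) * (- \<i>) * (torus_char (axis i 1) x + (- 1) * torus_char (- axis i 1) x))" for x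
    using arg_cong[OF expand[of "torus_embed x"], of complex_of_real]
    by (simp only: of_real_sum real_part torus_embed_def vec_lambda_beta cnj_torus_char)
  then show ?case
    by (simp only:) (intro trig_poly_sum trig_poly.intros)
next
  case (const c)
  show ?case by (rule trig_poly_const)
next
  case (add f g)
  then show ?case using trig_poly.add by fastforce
next
  case (mult f g)
  then show ?case using trig_poly_mult by fastforce
qed

text \<open>
  A periodic function factors through the embedding of the torus. The factor is continuous because
  its preimages of closed sets are images of compact subsets of the unit cube.
\<close>

lemma trig_poly_dense_real:
  fixes g :: "real ^ 'n \<Rightarrow> real"
  assumes cont: "continuous_on UNIV g" and per: "\<And>x m. g (x + of_int_vec m) = g x" and "0 < e"
  obtains p where "trig_poly p" "\<And>x. norm (of_real (g x) - p x) < e"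
proof -
  define K where "K = range (torus_embed :: real ^ 'n \<Rightarrow> _)"
  define \<psi> where "\<psi> z = g (inv torus_embed z)" for z
  have \<psi>: "\<psi> (torus_embed x) = g x" for x
  proof -
    have "torus_embed (inv torus_embed (torus_embed x)) = torus_embed x"
      by (rule f_inv_into_f) auto
    then show ?thesis unfolding \<psi>_def using per by (metis torus_embed_eqD)
  qed
  have K: "K = torus_embed ` cbox 0 1"
    unfolding K_def using torus_embed_periodic translate_into_unit_cube by (metis (no_types, lifting) UNIV_I image_eqI image_subset_iff subset_UNIV subset_antisym)
  have comp: "compact K"
    unfolding K by (intro compact_continuous_image continuous_torus_embed compact_cbox)
  have "continuous_on K \<psi>"
  proof (subst continuous_on_closed_vimage[OF compact_imp_closed[OF comp]], intro allI impI)
    fix B :: "real set" assume B: "closed B"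
    have "\<psi> -` B \<inter> K = torus_embed ` (cbox 0 1 \<inter> g -` B)"
      unfolding K by (auto simp: \<psi>)
    also have "compact \<dots>"
      using B cont
      by (intro compact_continuous_image continuous_torus_embed compact_Int_closed compact_cbox)
         (simp add: continuous_on_closed_vimage)
    finally show "closed (\<psi> -` B \<inter> K)" by (rule compact_imp_closed)
  qed
  from Stone_Weierstrass_real_polynomial_function[OF comp this \<open>0 < e\<close>]
  obtain p where p: "real_polynomial_function p" "\<And>z. z \<in> K \<Longrightarrow> \<bar>\<psi> z - p z\<bar> < e" by blast
  show ?thesis
  proof (rule that[OF trig_poly_real_polynomial[OF p(1)]])
    fix x
    show "norm (of_real (g x) - of_real (p (torus_embed x)) :: complex) < e"
      using p(2)[of "torus_embed x"] unfolding \<psi> of_real_diff[symmetric] norm_of_real K_def by blast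
  qed
qed

lemma integral_times_trig_poly_eq_0:
  assumes cont: "continuous_on UNIV \<phi>" and zero: "\<And>k. torus_coeff \<phi> k = 0" and p: "trig_poly p"
  shows "((\<lambda>x. \<phi> x * p x) has_integral 0) (cbox 0 1)"
  using p
proof (induction p rule: trig_poly.induct)
  case (char k)
  have "integral (cbox 0 1) (\<lambda>x. \<phi> x * torus_char k x) = 0"
    using zero[of "- k"] torus_coeff_eq_integral[OF cont, of "- k"] by simp
  then show ?case using integrable_integral[OF integrable_times_torus_char[OF cont]] by metis
next
  case (scale p c)
  then show ?case using has_integral_mult_right[OF scale.IH, of c] by (simp add: mult.left_commute)
next
  case (add p q)
  then show ?case using has_integral_add[OF add.IH] by (simp add: distrib_left)
qed

text \<open>
  Such a \<open>\<phi>\<close> is orthogonal to all trigonometric polynomials, hence to their uniform limit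
  \<open>cnj \<phi>\<close>, so the integral of \<open>(norm (\<phi> x))\<^sup>2\<close> vanishes.
\<close>

lemma fourier_uniqueness:
  fixes \<phi> :: "real ^ 'n \<Rightarrow> complex"
  assumes cont: "continuous_on UNIV \<phi>" and per: "periodic \<phi>" and zero: "\<And>k. torus_coeff \<phi> k = 0"
  shows "\<phi> x = 0"
proof -
  have "bounded (\<phi> ` cbox 0 1)"
    by (intro compact_imp_bounded compact_continuous_image continuous_on_subset[OF cont] compact_cbox) auto
  then obtain B where B: "\<And>x. x \<in> cbox 0 1 \<Longrightarrow> norm (\<phi> x) \<le> B" "B > 0"
    by (auto simp: bounded_pos)
  let ?I = "integral (cbox 0 1) (\<lambda>x. \<phi> x * cnj (\<phi> x))"
  have int: "(\<lambda>x. \<phi> x * cnj (\<phi> x)) integrable_on cbox 0 1"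
    by (intro integrable_continuous continuous_intros continuous_on_subset[OF cont]) auto
  have "norm ?I \<le> e" if "e > 0" for e
  proof -
    define d where "d = e / (2 * B)"
    have d: "d > 0" using that B by (simp add: d_def)
    have "continuous_on UNIV (\<lambda>x. Re (\<phi> x))" "continuous_on UNIV (\<lambda>x. Im (\<phi> x))"
      by (intro continuous_intros cont)+
    moreover have "Re (\<phi> (x + of_int_vec m)) = Re (\<phi> x)" "Im (\<phi> (x + of_int_vec m)) = Im (\<phi> x)" for x m
      using per by (simp_all add: periodic_def)
    ultimately obtain p q where p: "trig_poly p" "\<And>x. norm (of_real (Re (\<phi> x)) - p x) < d"
      and q: "trig_poly q" "\<And>x. norm (of_real (Im (\<phi> x)) - q x) < d"
      using trig_poly_dense_real[OF _ _ d] by metis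
    \<comment> \<open>a trigonometric polynomial within \<open>2 * d\<close> of \<open>cnj \<phi>\<close>\<close>
    define r where "r x = p x + (- \<i>) * q x" for x
    have "trig_poly r" unfolding r_def by (intro trig_poly.intros p q)
    from integral_times_trig_poly_eq_0[OF cont zero this]
    have r0: "((\<lambda>x. \<phi> x * r x) has_integral 0) (cbox 0 1)" .
    have "((\<lambda>x. \<phi> x * cnj (\<phi> x) - \<phi> x * r x) has_integral ?I - 0) (cbox 0 1)"
      by (intro has_integral_diff r0 integrable_integral[OF int])
    moreover have "norm (\<phi> x * cnj (\<phi> x) - \<phi> x * r x) \<le> e" if "x \<in> cbox 0 1" for x
    proof -
      have "cnj (\<phi> x) - r x = (of_real (Re (\<phi> x)) - p x) - \<i> * (of_real (Im (\<phi> x)) - q x)"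
        by (simp add: r_def complex_eq_iff)
      also have "norm \<dots> \<le> d + d"
        by (rule order.trans[OF norm_triangle_ineq4 add_mono])
           (use p(2)[of x] q(2)[of x] in \<open>simp_all only: norm_mult norm_ii mult_1_left less_imp_le\<close>)
      finally have "norm (\<phi> x) * norm (cnj (\<phi> x) - r x) \<le> B * (d + d)"
        using B that d by (intro mult_mono) auto
      then show ?thesis
        using B by (simp add: d_def norm_mult[symmetric] right_diff_distrib)
    qed
    ultimately have "norm (?I - 0) \<le> e * measure lborel (cbox (0 :: real ^ 'n) 1)"
      using that by (intro has_integral_bound) auto
    then show ?thesis by (simp add: content_cbox_cart interval_eq_empty_cart)
  qed
  then have "norm ?I \<le> 0" by (rule field_le_epsilon) simp
  then have "((\<lambda>x. \<phi> x * cnj (\<phi> x)) has_integral 0) (cbox 0 1)"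
    using integrable_integral[OF int] by simp
  then have "((\<lambda>x. Re (\<phi> x * cnj (\<phi> x))) has_integral Re 0) (cbox 0 1)"
    by (rule has_integral_linear[OF _ bounded_linear_Re, unfolded o_def])
  then have sq: "((\<lambda>x. (norm (\<phi> x))\<^sup>2) has_integral 0) (cbox 0 1)"
    by (simp add: complex_mult_cnj cmod_power2)
  have "(norm (\<phi> y))\<^sup>2 = 0" if "y \<in> cbox 0 1" for y
  proof (rule has_integral_0_cbox_imp_0[OF _ _ sq _ that])
    show "continuous_on (cbox 0 1) (\<lambda>x. (norm (\<phi> x))\<^sup>2)"
      by (intro continuous_intros continuous_on_subset[OF cont]) auto
    show "box 0 1 \<noteq> ({} :: (real ^ 'n) set)" by (simp add: interval_eq_empty_cart)
  qed simp
  moreover obtain m where "x + of_int_vec m \<in> cbox 0 1" by (rule translate_into_unit_cube)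
  moreover have "\<phi> (x + of_int_vec m) = \<phi> x" using per by (simp add: periodic_def)
  ultimately show ?thesis by force
qed

section \<open>Fourier series of test functions\<close>

lemma continuous_trig_series: "rapid c \<Longrightarrow> continuous_on S (trig_series c)"
  by (rule test_function_continuous[OF trig_series_test_function])

lemma torus_coeff_trig_series:
  fixes c :: "int ^ 'n \<Rightarrow> complex"
  assumes c: "rapid c"
  shows "torus_coeff (trig_series c) k = c k"
proof -
  let ?M = "restrict_space lborel (cbox (0 :: real ^ 'n) 1)"
  have eq: "(\<integral>t. f t \<partial>?M) = integral (cbox 0 1) f" if "continuous_on UNIV f" for f :: "real ^ 'n \<Rightarrow> complex"
  proof -
    have "set_integrable lborel (cbox 0 1) f"
      unfolding set_integrable_def
      by (intro borel_integrable_compact continuous_on_subset[OF that]) auto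
    from set_borel_integral_eq_integral(2)[OF this] show ?thesis
      by (simp add: integral_restrict_space set_lebesgue_integral_def)
  qed
  have meas: "f \<in> borel_measurable ?M" if "continuous_on UNIV f" for f :: "real ^ 'n \<Rightarrow> complex"
    by (rule measurable_restrict_space1) (simp add: borel_measurable_continuous_onI that)
  have cont: "continuous_on UNIV (\<lambda>t. torus_char l t * torus_char (- k) t)" for l :: "int ^ 'n"
    by (intro continuous_intros)
  have contS: "continuous_on UNIV (\<lambda>t. trig_series c t * torus_char (- k) t)"
    by (intro continuous_intros continuous_trig_series c)
  have "((\<lambda>l. c l * (\<integral>t. torus_char l t * torus_char (- k) t \<partial>?M)) has_sum
      (\<integral>t. trig_series c t * torus_char (- k) t \<partial>?M)) UNIV"
  proof (rule has_sum_integral_dominated)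
    show "finite_measure ?M"
      by (rule finite_measureI) (simp add: space_restrict_space emeasure_restrict_space emeasure_lborel_cbox_eq)
    show "((\<lambda>l. c l * (torus_char l t * torus_char (- k) t)) has_sum trig_series c t * torus_char (- k) t) UNIV" for t
      using has_sum_cmult_left[OF trig_series_has_sum[OF rapid_summable[OF c]]] by (simp add: mult.assoc)
  qed (auto simp: norm_mult intro!: rapid_summable c meas cont contS)
  moreover have "(\<integral>t. torus_char l t * torus_char (- k) t \<partial>?M) = (if l = k then 1 else 0)" for l
  proof -
    have "(\<lambda>t. torus_char l t * torus_char (- k) t) = torus_char (l + - k)"
      by (rule ext) (rule torus_char_add[symmetric])
    then show ?thesis using eq[OF cont[of l]] by (simp add: integral_torus_char)
  qed
  ultimately have "((\<lambda>l. c l * (if l = k then 1 else 0)) has_sum torus_coeff (trig_series c) k) UNIV"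
    unfolding eq[OF contS] torus_coeff_eq_integral[OF continuous_trig_series[OF c]] by simp
  moreover have "((\<lambda>l. c l * (if l = k then 1 else 0)) has_sum c k) UNIV"
    by (rule has_sum_finite_neutralI[of "{k}"]) auto
  ultimately show ?thesis by (rule has_sum_unique)
qed

lemma torus_coeff_diff:
  assumes g: "continuous_on UNIV g" and h: "continuous_on UNIV h"
  shows "torus_coeff (\<lambda>x. g x - h x) k = torus_coeff g k - torus_coeff h k"
  unfolding torus_coeff_eq_integral[OF g] torus_coeff_eq_integral[OF h]
    torus_coeff_eq_integral[OF continuous_on_diff[OF g h]] left_diff_distrib
  by (intro integral_diff integrable_times_torus_char g h)

text \<open>
  Both sides are continuous, periodic and have the same Fourier coefficients.
\<close>

lemma test_function_eq_trig_series:
  assumes h: "h \<in> test_functions"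
  shows "h = trig_series (torus_coeff h)"
proof
  fix x
  let ?g = "trig_series (torus_coeff h)"
  have g: "?g \<in> test_functions" by (intro trig_series_test_function rapid_torus_coeff h)
  have cont: "continuous_on UNIV h" "continuous_on UNIV ?g"
    by (intro test_function_continuous h g)+
  have "h x - ?g x = 0"
  proof (rule fourier_uniqueness[of "\<lambda>x. h x - ?g x"])
    show "continuous_on UNIV (\<lambda>x. h x - ?g x)" by (intro continuous_intros cont)
    show "periodic (\<lambda>x. h x - ?g x)"
      using test_function_periodic[OF h] test_function_periodic[OF g] by (simp add: periodic_def)
    fix k
    show "torus_coeff (\<lambda>x. h x - ?g x) k = 0"
      unfolding torus_coeff_diff[OF cont]
      by (simp add: torus_coeff_trig_series rapid_torus_coeff h)
  qed
  then show "h x = ?g x" by simp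
qed

lemma trig_series_scale: "trig_series (\<lambda>k. a * c k) x = a * trig_series c x"
  unfolding trig_series_def mult.assoc by (rule infsum_cmult_right')

lemma rapid_scale: "rapid c \<Longrightarrow> rapid (\<lambda>k. a * c k)"
  by (erule rapid_dominated[of _ _ "norm a" 0]) (simp add: norm_mult)

lemma test_function_scale:
  assumes h: "h \<in> test_functions"
  shows "(\<lambda>x. a * h x) \<in> test_functions"
proof -
  have "(\<lambda>x. a * h x) = trig_series (\<lambda>k. a * torus_coeff h k)"
    unfolding trig_series_scale[abs_def] test_function_eq_trig_series[OF h, symmetric] ..
  then show ?thesis
    by (simp only: trig_series_test_function rapid_scale rapid_torus_coeff h)
qed

section \<open>Fourier series of distributions\<close>

lemma Ck_norm_trig_series_le:
  assumes "rapid c"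
  shows "Ck_norm N (trig_series c) \<le> (\<Sum>is | length is \<le> N. \<Sum>\<^sub>\<infinity>k. norm (deriv_symbol is k * c k))"
  unfolding Ck_norm_def iter_partial_trig_series[OF assms]
  by (intro sum_mono cSUP_least norm_trig_series_le rapid_summable rapid_deriv_symbol assms) simp

lemma distribution_diff:
  assumes u: "distribution u" and g: "g \<in> test_functions" and h: "h \<in> test_functions"
  shows "u (\<lambda>x. g x - h x) = u g - u h"
proof -
  have "u (\<lambda>x. g x + (- 1) * h x) = u g + (- 1) * u h"
    using u g h test_function_scale[OF h, of "- 1"] unfolding distribution_def by metis
  then show ?thesis by simp
qed

lemma trig_series_restrict:
  "finite F \<Longrightarrow> trig_series (\<lambda>k. if k \<in> F then c k else 0) x = (\<Sum>k\<in>F. c k * torus_char k x)"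
  unfolding trig_series_def
  by (rule infsumI) (rule has_sum_finite_neutralI[of F], auto)

lemma distribution_trig_poly:
  assumes u: "distribution u" and F: "finite F"
  shows "u (trig_series (\<lambda>k. if k \<in> F then c k else 0)) = (\<Sum>k\<in>F. c k * u (torus_char k))"
  using F
proof (induction F)
  case empty
  have "u (\<lambda>x. 0 * torus_char 0 x) = 0 * u (torus_char 0)"
    using u torus_char_test_function unfolding distribution_def by blast
  then show ?case by (simp add: trig_series_def[abs_def])
next
  case (insert l F)
  let ?g = "trig_series (\<lambda>k. if k \<in> F then c k else 0)"
  have g: "?g \<in> test_functions"
    by (intro trig_series_test_function rapid_finite_support[of F]) (auto simp: insert)
  have ch: "(\<lambda>x. c l * torus_char l x) \<in> test_functions"
    by (rule test_function_scale[OF torus_char_test_function])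
  have "trig_series (\<lambda>k. if k \<in> insert l F then c k else 0) = (\<lambda>x. c l * torus_char l x + ?g x)"
    using insert.hyps by (simp only: fun_eq_iff trig_series_restrict finite_insert) simp
  then have "u (trig_series (\<lambda>k. if k \<in> insert l F then c k else 0)) = u (\<lambda>x. c l * torus_char l x) + u ?g"
    using u ch g unfolding distribution_def by simp
  also have "u (\<lambda>x. c l * torus_char l x) = c l * u (torus_char l)"
    using u torus_char_test_function unfolding distribution_def by blast
  finally show ?case using insert by simp
qed

text \<open>
  The difference between \<open>h\<close> and a partial sum of its Fourier series is again a trigonometric series,
  so its \<open>C\<^sup>N\<close> norm is at most a finite sum of tails of absolutely convergent series. Continuity of
  \<open>u\<close> transfers the convergence to the pairing.
\<close>

lemma distribution_fourier_series:
  assumes u: "distribution u" and h: "h \<in> test_functions"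
  shows "((\<lambda>k. torus_coeff h k * u (torus_char k)) has_sum u h) UNIV"
proof -
  obtain C N where bound: "\<And>g. g \<in> test_functions \<Longrightarrow> norm (u g) \<le> C * Ck_norm N g"
    using u unfolding distribution_def by blast
  define c where "c = torus_coeff h"
  have c: "rapid c" unfolding c_def by (rule rapid_torus_coeff[OF h])
  define b where "b F k = (if k \<in> F then 0 else c k)" for F k
  define a where "a F k = (if k \<in> F then c k else 0)" for F k
  have b: "rapid (b F)" and a: "rapid (a F)" for F
    by (rule rapid_dominated[OF c, of _ 1 0]; simp add: b_def a_def)+
  have le: "norm ((\<Sum>k\<in>F. c k * u (torus_char k)) - u h)
      \<le> \<bar>C\<bar> * (\<Sum>is | length is \<le> N. \<Sum>\<^sub>\<infinity>k. if k \<in> F then 0 else norm (deriv_symbol is k * c k))"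
    if F: "finite F" for F
  proof -
    have "(\<lambda>x. h x - trig_series (a F) x) = trig_series (b F)"
    proof
      fix x
      have "((\<lambda>k. c k * torus_char k x - a F k * torus_char k x) has_sum (h x - trig_series (a F) x)) UNIV"
        using trig_series_has_sum[OF rapid_summable[OF c]] trig_series_has_sum[OF rapid_summable[OF a]]
        unfolding c_def test_function_eq_trig_series[OF h, symmetric] by (intro has_sum_diff)
      moreover have "(\<lambda>k. c k * torus_char k x - a F k * torus_char k x) = (\<lambda>k. b F k * torus_char k x)"
        by (simp add: fun_eq_iff a_def b_def)
      ultimately show "h x - trig_series (a F) x = trig_series (b F) x"
        using trig_series_has_sum[OF rapid_summable[OF b]] has_sum_unique by metis
    qed
    moreover have "u (\<lambda>x. h x - trig_series (a F) x) = u h - u (trig_series (a F))"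
      by (rule distribution_diff[OF u h trig_series_test_function[OF a]])
    moreover have "u (trig_series (a F)) = (\<Sum>k\<in>F. c k * u (torus_char k))"
      unfolding a_def by (rule distribution_trig_poly[OF u F])
    ultimately have "norm ((\<Sum>k\<in>F. c k * u (torus_char k)) - u h) = norm (u (trig_series (b F)))"
      by (simp add: norm_minus_commute)
    also have "\<dots> \<le> C * Ck_norm N (trig_series (b F))"
      by (intro bound trig_series_test_function b)
    also have "\<dots> \<le> \<bar>C\<bar> * Ck_norm N (trig_series (b F))"
    proof (rule mult_right_mono)
      have "bdd_above (range (\<lambda>x. norm (iter_partial is (trig_series (b F)) x)))" for "is"
        unfolding iter_partial_trig_series[OF b]
        by (rule bdd_aboveI2[OF norm_trig_series_le[OF rapid_summable[OF rapid_deriv_symbol[OF b]]]])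
      then show "0 \<le> Ck_norm N (trig_series (b F))"
        unfolding Ck_norm_def by (intro sum_nonneg cSUP_upper2[where x = 0]) auto
    qed simp
    also have "\<dots> \<le> \<bar>C\<bar> * (\<Sum>is | length is \<le> N. \<Sum>\<^sub>\<infinity>k. norm (deriv_symbol is k * b F k))"
      by (intro mult_left_mono Ck_norm_trig_series_le b) simp
    also have "(\<lambda>is. \<Sum>\<^sub>\<infinity>k. norm (deriv_symbol is k * b F k))
        = (\<lambda>is. \<Sum>\<^sub>\<infinity>k. if k \<in> F then 0 else norm (deriv_symbol is k * c k))"
      by (intro ext infsum_cong) (simp add: b_def)
    finally show ?thesis .
  qed
  have "((\<lambda>F. (\<Sum>k\<in>F. c k * u (torus_char k)) - u h) \<longlongrightarrow> 0) (finite_subsets_at_top UNIV)"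
  proof (rule Lim_null_comparison)
    show "\<forall>\<^sub>F F in finite_subsets_at_top UNIV. norm ((\<Sum>k\<in>F. c k * u (torus_char k)) - u h)
      \<le> \<bar>C\<bar> * (\<Sum>is | length is \<le> N. \<Sum>\<^sub>\<infinity>k. if k \<in> F then 0 else norm (deriv_symbol is k * c k))"
      by (rule eventually_finite_subsets_at_top_weakI) (rule le)
    show "((\<lambda>F. \<bar>C\<bar> * (\<Sum>is | length is \<le> N. \<Sum>\<^sub>\<infinity>k. if k \<in> F then 0 else norm (deriv_symbol is k * c k))) \<longlongrightarrow> 0)
      (finite_subsets_at_top UNIV)"
      by (intro tendsto_mult_right_zero tendsto_null_sum infsum_tail_tendsto_0 rapid_summable rapid_deriv_symbol c)
  qed
  then have "((\<lambda>k. c k * u (torus_char k)) has_sum u h) UNIV"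
    unfolding has_sum_def by (rule Lim_null[THEN iffD2])
  then show ?thesis by (simp add: c_def)
qed

lemma distribution_parseval:
  assumes u: "distribution u" and h: "h \<in> test_functions"
  shows "((\<lambda>k. fourier_coeff u k * torus_coeff h (- k)) has_sum u h) UNIV"
proof -
  have "((\<lambda>k. torus_coeff h (- k) * u (torus_char (- k))) has_sum u h) UNIV"
    using distribution_fourier_series[OF u h]
    by (subst has_sum_reindex_bij_witness[of UNIV uminus uminus UNIV "\<lambda>k. torus_coeff h k * u (torus_char k)" _ "u h"]) auto
  then show ?thesis by (simp add: fourier_coeff_eq[of u] mult.commute)
qed

section \<open>Averages over rational planes\<close>

lemma common_denominator:
  fixes b :: "rat ^ 'n"
  obtains N :: int and z :: "int ^ 'n" where "N > 0" "of_int_vec z = of_int N *s b"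
proof -
  have "\<exists>p q. q > 0 \<and> b $ i = of_int p / of_int q" for i
    by (metis quotient_of_denom_pos quotient_of_div surj_pair)
  then obtain p q where pq: "\<And>i. q i > 0" "\<And>i. b $ i = of_int (p i) / of_int (q i)" by metis
  show ?thesis
  proof (rule that)
    show "(\<Prod>i\<in>UNIV. q i) > 0" by (intro prod_pos) (simp add: pq)
    have "of_int (p i * (\<Prod>j\<in>UNIV - {i}. q j)) = of_int (\<Prod>i\<in>UNIV. q i) * b $ i" for i
    proof -
      have "q i \<noteq> 0" using pq(1)[of i] by simp
      moreover have "(\<Prod>j\<in>UNIV. q j) = q i * (\<Prod>j\<in>UNIV - {i}. q j)"
        by (rule prod.remove) auto
      ultimately show ?thesis by (simp add: pq(2))
    qed
    then show "of_int_vec (\<chi> i. p i * (\<Prod>j\<in>UNIV - {i}. q j)) = of_int (\<Prod>i\<in>UNIV. q i) *s b"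
      by (simp add: vec_eq_iff of_int_vec_def del: of_int_mult of_int_prod)
  qed
qed

text \<open>
  Clearing denominators in a basis of \<open>A\<close> keeps the span. Independence and injectivity of the
  scaled family follow by counting: \<open>d\<close> vectors that span a space of dimension \<open>d\<close> form a basis.
\<close>

lemma int_basis_exists:
  fixes A :: "(rat ^ 'n) set"
  assumes "A \<in> Gr d"
  shows "\<exists>v. int_basis d A v"
proof -
  have A: "vec.subspace A" "vec.dim A = d" using assms by (auto simp: Gr_def)
  obtain B where B: "B \<subseteq> A" "vec.independent B" "A \<subseteq> vec.span B" "card B = d"
    using vec.basis_exists[of A] A(2) by metis
  have "finite B" using B(2) by (rule vec.finiteI_independent)
  then obtain f where f: "bij_betw f {..<d} B"
    using B(4) by (metis ex_bij_betw_nat_finite atLeast0LessThan)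
  have "\<exists>N z. N > 0 \<and> of_int_vec z = of_int N *s f i" for i
    using common_denominator[of "f i"] by metis
  then obtain N v where v: "\<And>i. (N i :: int) > 0" "\<And>i. of_int_vec (v i) = of_int (N i) *s f i" by metis
  let ?V = "(\<lambda>i. of_int_vec (v i) :: rat ^ 'n) ` {..<d}"
  have VA: "?V \<subseteq> A"
  proof -
    have "f i \<in> A" if "i < d" for i using f B(1) that by (auto simp: bij_betw_def)
    then show ?thesis using A(1) by (auto simp: v vec.subspace_scale)
  qed
  have "B \<subseteq> vec.span ?V"
  proof
    fix b assume "b \<in> B"
    then obtain i where i: "i < d" "b = f i" using f by (auto simp: bij_betw_def)
    have "b = (1 / of_int (N i)) *s of_int_vec (v i)"
      using v(1)[of i] by (simp add: v(2) i(2) vector_smult_assoc)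
    moreover have "(1 / of_int (N i)) *s of_int_vec (v i) \<in> vec.span ?V"
      by (intro vec.span_scale vec.span_base) (use i(1) in auto)
    ultimately show "b \<in> vec.span ?V" by (simp only:)
  qed
  then have AV: "A \<subseteq> vec.span ?V" using B(3) vec.span_minimal[OF _ vec.subspace_span] by blast
  have "d \<le> card ?V" using vec.dim_le_card[OF AV] A(2) by simp
  then have card: "card ?V = d" using card_image_le[of "{..<d}" "\<lambda>i. of_int_vec (v i) :: rat ^ 'n"] by simp
  have "inj_on (\<lambda>i. of_int_vec (v i) :: rat ^ 'n) {..<d}"
    by (rule eq_card_imp_inj_on) (simp_all add: card)
  then have "inj_on v {..<d}" by (auto simp: inj_on_def)
  moreover have "vec.independent ?V"
    by (rule vec.card_le_dim_spanning[OF VA AV]) (use card A in auto)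
  moreover have "vec.span ?V = A"
    using AV vec.span_minimal[OF VA A(1)] by blast
  ultimately show ?thesis unfolding int_basis_def by blast
qed

lemma perp_iff_int_basis:
  fixes A :: "(rat ^ 'n) set"
  assumes "int_basis d A v"
  shows "perp k A \<longleftrightarrow> (\<forall>i<d. (\<Sum>j\<in>UNIV. k $ j * v i $ j) = 0)"
proof -
  let ?V = "(\<lambda>i. of_int_vec (v i) :: rat ^ 'n) ` {..<d}"
  let ?H = "{a :: rat ^ 'n. (\<Sum>j\<in>UNIV. of_int (k $ j) * a $ j) = 0}"
  have A: "A = vec.span ?V" using assms by (simp add: int_basis_def)
  have "vec.subspace ?H"
    by (auto simp: vec.subspace_def distrib_left sum.distrib mult.left_commute sum_distrib_left[symmetric])
  then have "perp k A \<longleftrightarrow> ?V \<subseteq> ?H"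
    unfolding perp_def A using vec.span_minimal[of ?V ?H] vec.span_superset[of ?V] by blast
  also have "\<dots> \<longleftrightarrow> (\<forall>i<d. (\<Sum>j\<in>UNIV. k $ j * v i $ j) = 0)"
  proof -
    have "(\<Sum>j\<in>UNIV. of_int (k $ j) * of_int_vec (v i) $ j) = (of_int (\<Sum>j\<in>UNIV. k $ j * v i $ j) :: rat)" for i
      by (simp add: of_int_vec_def)
    then show ?thesis by (auto simp del: of_int_sum)
  qed
  finally show ?thesis .
qed

lemma perp_uminus [simp]: "perp (- k) A \<longleftrightarrow> perp k A"
  by (simp add: perp_def sum_negf)

lemma integral_cis_period:
  fixes m :: int
  shows "(LINT s:{0..1}|lborel. cis (2 * pi * of_int m * s)) = (if m = 0 then 1 else 0)"
proof -
  have "set_integrable lborel {0..1} (\<lambda>s. cis (2 * pi * of_int m * s))"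
    by (intro borel_integrable_atLeastAtMost' continuous_intros)
  then have eq: "(LINT s:{0..1}|lborel. cis (2 * pi * of_int m * s)) = integral {0..1} (\<lambda>s. cis (2 * pi * of_int m * s))"
    by (rule set_borel_integral_eq_integral)
  show ?thesis
  proof (cases "m = 0")
    case False
    define w where "w = 2 * pi * of_int m"
    have w: "w \<noteq> 0" using False by (simp add: w_def)
    have "((\<lambda>s. cis (w * s)) has_integral (cis (w * 1) / (\<i> * of_real w) - cis (w * 0) / (\<i> * of_real w))) {0..1}"
    proof (rule fundamental_theorem_of_calculus)
      fix s :: real
      have "((\<lambda>z. exp (\<i> * of_real w * z) / (\<i> * of_real w)) has_field_derivative exp (\<i> * of_real w * of_real s))
          (at (of_real s))"
        using w by (auto intro!: derivative_eq_intros)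
      then have "((\<lambda>s. exp (\<i> * of_real w * of_real s) / (\<i> * of_real w)) has_vector_derivative exp (\<i> * of_real w * of_real s)) (at s within {0..1})"
        by (rule has_vector_derivative_real_field)
      then show "((\<lambda>s. cis (w * s) / (\<i> * of_real w)) has_vector_derivative cis (w * s)) (at s within {0..1})"
        by (simp add: cis_conv_exp mult.assoc)
    qed simp
    moreover have "cis (w * 1) = 1" unfolding w_def using cis_multiple_2pi[of "of_int m"] by simp
    ultimately show ?thesis using False by (simp add: eq w_def integral_unique)
  next
    case True
    then show ?thesis unfolding eq by simp
  qed
qed

text \<open>
  The unit cube as a measure space of its own, so that the results on finite measures apply to the
  average over \<open>A\<close>.
\<close>

definition cube_measure :: "nat \<Rightarrow> (nat \<Rightarrow> real) measure" where
  "cube_measure d = restrict_space (\<Pi>\<^sub>M i\<in>{..<d}. lborel) (\<Pi>\<^sub>E i\<in>{..<d}. {0..1})"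

definition plane_point :: "nat \<Rightarrow> (nat \<Rightarrow> int ^ 'n) \<Rightarrow> (nat \<Rightarrow> real) \<Rightarrow> real ^ 'n" where
  "plane_point d v t = (\<Sum>i<d. t i *\<^sub>R of_int_vec (v i))"

lemma unit_cube_in_sets: "(\<Pi>\<^sub>E i\<in>{..<d}. {0..1}) \<in> sets (\<Pi>\<^sub>M i\<in>{..<d::nat}. (lborel :: real measure))"
  by (rule sets_PiM_I_finite) auto

lemma integral_cube_measure:
  "(\<integral>t. F t \<partial>cube_measure d) =
     (LINT t : (\<Pi>\<^sub>E i\<in>{..<d}. {0..1}) | (\<Pi>\<^sub>M i\<in>{..<d}. lborel). F t :: complex)"
  unfolding cube_measure_def set_lebesgue_integral_def
  using unit_cube_in_sets by (intro integral_restrict_space) (simp add: sets.Int_space_eq2)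

lemma finite_measure_cube: "finite_measure (cube_measure d)"
proof -
  interpret product_sigma_finite "\<lambda>_ :: nat. lborel :: real measure" by standard
  have "emeasure (\<Pi>\<^sub>M i\<in>{..<d}. lborel) (\<Pi>\<^sub>E i\<in>{..<d}. {0..1::real}) = 1"
    by (subst emeasure_PiM) auto
  then show ?thesis
    unfolding cube_measure_def
    by (intro finite_measureI)
       (simp add: space_restrict_space emeasure_restrict_space unit_cube_in_sets sets.Int_space_eq2 Int_commute)
qed

lemma measurable_plane_point: "plane_point d v \<in> borel_measurable (cube_measure d)"
proof -
  have "(\<lambda>t. t i) \<in> borel_measurable (\<Pi>\<^sub>M i\<in>{..<d}. lborel)" if "i < d" for i
    using measurable_component_singleton[of i "{..<d}" "\<lambda>_. lborel :: real measure"] that by simp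
  then show ?thesis
    unfolding plane_point_def[abs_def] cube_measure_def
    by (intro measurable_restrict_space1 borel_measurable_sum borel_measurable_scaleR) auto
qed

text \<open>
  On the plane the character is a product of one-variable exponentials with the integer frequencies
  \<open>k \<bullet> v i\<close>; each factor has mean \<open>0\<close> over a period unless its frequency is \<open>0\<close>.
\<close>

lemma integral_torus_char_plane:
  assumes "int_basis d A v"
  shows "(\<integral>t. torus_char k (plane_point d v t) \<partial>cube_measure d) = (if perp k A then 1 else 0)"
proof -
  interpret product_sigma_finite "\<lambda>_ :: nat. lborel :: real measure" by standard
  let ?P = "\<Pi>\<^sub>M i\<in>{..<d}. (lborel :: real measure)"
  define m where "m i = (\<Sum>j\<in>UNIV. k $ j * v i $ j)" for i
  let ?f = "\<lambda>i s. indicator {0..1} s *\<^sub>R cis (2 * pi * of_int (m i) * s)"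
  have "torus_char k (plane_point d v t) = (\<Prod>i<d. cis (2 * pi * of_int (m i) * t i))" for t
  proof -
    have "2 * pi * (of_int_vec k \<bullet> plane_point d v t) = (\<Sum>i<d. 2 * pi * of_int (m i) * t i)"
      by (simp add: plane_point_def inner_sum_right inner_of_int_vec_of_int_vec m_def sum_distrib_left mult_ac
          del: of_int_sum)
    moreover have "cis (sum g {..<d}) = (\<Prod>i<d. cis (g i))" for g :: "nat \<Rightarrow> real"
      by (induction d) (simp_all add: cis_mult[symmetric])
    ultimately show ?thesis by (simp add: torus_char_def)
  qed
  then have "(\<integral>t. torus_char k (plane_point d v t) \<partial>cube_measure d) = (\<integral>t. (\<Prod>i<d. ?f i (t i)) \<partial>?P)"
    unfolding integral_cube_measure set_lebesgue_integral_def
  proof (intro Bochner_Integration.integral_cong refl)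
    fix t assume t: "t \<in> space ?P"
    have "indicator (\<Pi>\<^sub>E i\<in>{..<d}. {0..1}) t = (\<Prod>i<d. indicator {0..1} (t i) :: real)"
    proof (cases "t \<in> (\<Pi>\<^sub>E i\<in>{..<d}. {0..1})")
      case True
      then show ?thesis by (auto simp: PiE_iff indicator_def)
    next
      case False
      then obtain i where "i < d" "t i \<notin> {0..1}" using t by (auto simp: space_PiM PiE_iff)
      then show ?thesis using False by (auto simp: indicator_def intro!: prod_zero[symmetric] bexI[of _ i])
    qed
    then show "indicator (\<Pi>\<^sub>E i\<in>{..<d}. {0..1}) t *\<^sub>R torus_char k (plane_point d v t) = (\<Prod>i<d. ?f i (t i))"
      using \<open>\<And>t. torus_char k (plane_point d v t) = _ t\<close> by (simp add: scaleR_conv_of_real prod.distrib)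
  qed
  also have "\<dots> = (\<Prod>i<d. \<integral>s. ?f i s \<partial>lborel)"
  proof (rule product_integral_prod)
    show "integrable lborel (?f i)" for i
      using borel_integrable_atLeastAtMost'[of 0 1 "\<lambda>s. cis (2 * pi * of_int (m i) * s)"]
      by (simp add: set_integrable_def continuous_intros)
  qed simp
  also have "\<dots> = (\<Prod>i<d. if m i = 0 then 1 else 0)"
    using integral_cis_period by (simp add: set_lebesgue_integral_def)
  also have "\<dots> = (if \<forall>i<d. m i = 0 then 1 else 0)"
    by (auto intro!: prod_zero)
  also have "(\<forall>i<d. m i = 0) \<longleftrightarrow> perp k A"
    unfolding m_def perp_iff_int_basis[OF assms] ..
  finally show ?thesis .
qed

lemma radon_eq_average:
  assumes "A \<in> Gr d"
  obtains v where "int_basis d A v"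
    and "\<And>h x. radon d A h x = (\<integral>t. h (x + plane_point d v t) \<partial>cube_measure d)"
proof -
  define v where "v = (SOME v. int_basis d A v)"
  have "int_basis d A v" unfolding v_def by (rule someI_ex[OF int_basis_exists[OF assms]])
  moreover have "radon d A h x = (\<integral>t. h (x + plane_point d v t) \<partial>cube_measure d)" for h x
    unfolding radon_def integral_cube_measure plane_point_def by (simp add: v_def Let_def)
  ultimately show ?thesis by (rule that)
qed

lemma radon_torus_char:
  assumes "A \<in> Gr d"
  shows "radon d A (torus_char k) x = (if perp k A then torus_char k x else 0)"
proof -
  obtain v where v: "int_basis d A v"
    and radon: "\<And>h x. radon d A h x = (\<integral>t. h (x + plane_point d v t) \<partial>cube_measure d)"
    using radon_eq_average[OF assms] by blast
  show ?thesis
    unfolding radon torus_char_arg_add by (simp add: integral_torus_char_plane[OF v])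
qed

text \<open>
  The Fourier series may be averaged term by term because it converges uniformly. Masking
  coefficients preserves rapid decay, so the Radon transform of a test function is a test function;
  without this \<open>radon_dist\<close> would evaluate a distribution where nothing is known about it.
\<close>

lemma radon_eq_trig_series:
  fixes h :: "real ^ 'n \<Rightarrow> complex"
  assumes A: "A \<in> Gr d" and h: "h \<in> test_functions"
  shows "radon d A h = trig_series (\<lambda>k. if perp k A then torus_coeff h k else 0)"
proof
  fix x
  obtain v where v: "int_basis d A v"
    and radon: "\<And>h x. radon d A h x = (\<integral>t. h (x + plane_point d v t) \<partial>cube_measure d)"
    using radon_eq_average[OF A] by blast
  have meas: "(\<lambda>t. g (x + plane_point d v t)) \<in> borel_measurable (cube_measure d)"
    if "continuous_on UNIV g" for g :: "real ^ 'n \<Rightarrow> complex"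
    by (rule measurable_compose[OF _ borel_measurable_continuous_onI[OF that]])
       (intro borel_measurable_add borel_measurable_const measurable_plane_point)
  have summ: "(\<lambda>k. norm (torus_coeff h k)) summable_on UNIV"
    by (rule rapid_summable[OF rapid_torus_coeff[OF h]])
  have "((\<lambda>k. torus_coeff h k * (\<integral>t. torus_char k (x + plane_point d v t) \<partial>cube_measure d)) has_sum
      (\<integral>t. h (x + plane_point d v t) \<partial>cube_measure d)) UNIV"
  proof (rule has_sum_integral_dominated[OF finite_measure_cube summ])
    show "((\<lambda>k. torus_coeff h k * torus_char k (x + plane_point d v t)) has_sum h (x + plane_point d v t)) UNIV" for t
      using trig_series_has_sum[OF summ] unfolding test_function_eq_trig_series[OF h, symmetric] .
  qed (auto intro!: meas test_function_continuous h torus_char_test_function)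
  then have "((\<lambda>k. (if perp k A then torus_coeff h k else 0) * torus_char k x) has_sum radon d A h x) UNIV"
    unfolding radon[symmetric] radon_torus_char[OF A] by (simp add: if_distrib if_distribR cong: if_cong)
  then show "radon d A h x = trig_series (\<lambda>k. if perp k A then torus_coeff h k else 0) x"
    unfolding trig_series_def by (simp add: infsumI)
qed

lemma fourier_coeff_radon_dist:
  assumes f: "distribution f" and A: "A \<in> Gr d"
  shows "fourier_coeff (radon_dist d A f) k = (if perp k A then fourier_coeff f k else 0)"
proof (cases "perp k A")
  case True
  then have "radon d A (torus_char (- k)) = torus_char (- k)"
    by (simp add: fun_eq_iff radon_torus_char[OF A])
  then show ?thesis using True by (simp add: fourier_coeff_eq radon_dist_def)
next
  case False
  have "f (\<lambda>x. 0 * torus_char 0 x) = 0 * f (torus_char 0)"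
    using f torus_char_test_function unfolding distribution_def by blast
  moreover have "radon d A (torus_char (- k)) = (\<lambda>x. 0)"
    using False by (simp add: fun_eq_iff radon_torus_char[OF A])
  ultimately show ?thesis using False by (simp add: fourier_coeff_eq radon_dist_def)
qed

lemma radon_dist_has_sum:
  assumes f: "distribution f" and A: "A \<in> Gr d" and h: "h \<in> test_functions"
  shows "((\<lambda>k. if perp k A then fourier_coeff f k * torus_coeff h (- k) else 0) has_sum radon_dist d A f h) UNIV"
proof -
  let ?c = "\<lambda>k. if perp k A then torus_coeff h k else 0"
  have c: "rapid ?c"
    by (rule rapid_dominated[OF rapid_torus_coeff[OF h], of _ 1 0]) simp
  have "((\<lambda>k. fourier_coeff f k * torus_coeff (trig_series ?c) (- k)) has_sum f (trig_series ?c)) UNIV"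
    by (intro distribution_parseval f trig_series_test_function c)
  then show ?thesis
    unfolding torus_coeff_trig_series[OF c] radon_dist_def radon_eq_trig_series[OF A h]
    by (simp add: if_distrib cong: if_cong)
qed

section \<open>From iterated summability to summability over pairs\<close>

lemma summable_on_if_subset:
  fixes g :: "'k \<Rightarrow> complex"
  assumes "(\<lambda>k. norm (g k)) summable_on UNIV"
  shows "(\<lambda>k. if k \<in> E then g k else 0) summable_on UNIV"
proof (rule abs_summable_summable)
  show "(\<lambda>k. norm (if k \<in> E then g k else 0)) summable_on UNIV"
    by (rule summable_on_comparison_test[OF assms]) auto
qed

text \<open>
  A uniform boundedness principle, proved by a gliding hump on the sets \<open>E\<close>. Call the sets with
  prescribed intersection with a finite set \<open>K\<close> a cylinder. For finite \<open>F\<close> the partial sum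
  \<open>p F E\<close> is continuous in \<open>E\<close> for the topology of cylinders, because the rows are absolutely
  summable. If the partial sums were unbounded on every cylinder, one could choose nested
  cylinders on which they exceed \<open>1, 2, 3, \<dots>\<close>, and a set in all of them would contradict the
  summability assumed for it. So they are bounded by some \<open>r\<close> on a cylinder with base \<open>K\<close>. For
  \<open>k \<notin> K\<close>, inserting and removing \<open>k\<close> stays in the cylinder and changes the row sum of \<open>A\<close> by
  exactly \<open>a A k\<close>, which bounds the column of \<open>k\<close> by \<open>2 * r\<close>; the finitely many columns with
  \<open>k \<in> K\<close> are summable by taking \<open>E = {k}\<close>.
\<close>

lemma uniform_column_bound:
  fixes a :: "'a \<Rightarrow> 'k \<Rightarrow> complex"
  assumes row: "\<And>A. A \<in> G \<Longrightarrow> (\<lambda>k. norm (a A k)) summable_on UNIV"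
    and sub: "\<And>E. (\<lambda>A. norm (\<Sum>\<^sub>\<infinity>k. if k \<in> E then a A k else 0)) summable_on G"
  obtains B where "\<And>k F. finite F \<Longrightarrow> F \<subseteq> G \<Longrightarrow> (\<Sum>A\<in>F. norm (a A k)) \<le> B"
proof -
  define S where "S A E = (\<Sum>\<^sub>\<infinity>k. if k \<in> E then a A k else 0)" for A E
  define p where "p F E = (\<Sum>A\<in>F. norm (S A E))" for F E
  have S: "((\<lambda>k. if k \<in> E then a A k else 0) has_sum S A E) UNIV" if "A \<in> G" for A E
    unfolding S_def by (rule has_sum_infsum[OF summable_on_if_subset[OF row[OF that]]])
  have p_le: "p F E \<le> (\<Sum>\<^sub>\<infinity>A\<in>G. norm (S A E))" if "finite F" "F \<subseteq> G" for F E
    unfolding p_def using sub[of E, folded S_def] that by (intro finite_sum_le_infsum) auto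
  have open_cylinder: "\<exists>K. finite K \<and> (\<forall>E'. E' \<inter> K = E \<inter> K \<longrightarrow> p F E' > r)"
    if F: "finite F" "F \<subseteq> G" and r: "p F E > r" for F E r
  proof -
    let ?b = "\<lambda>k. \<Sum>A\<in>F. norm (a A k)"
    have b: "?b summable_on UNIV"
      by (rule has_sum_imp_summable[OF has_sum_finite_sum], rule has_sum_infsum)
         (use F row in auto)
    have "\<forall>\<^sub>F K in finite_subsets_at_top UNIV. (\<Sum>\<^sub>\<infinity>k. if k \<in> K then 0 else ?b k) < p F E - r"
      using order_tendstoD(2)[OF infsum_tail_tendsto_0[OF b]] r by simp
    then obtain K where K: "finite K" "(\<Sum>\<^sub>\<infinity>k. if k \<in> K then 0 else ?b k) < p F E - r"
      by (auto simp: eventually_finite_subsets_at_top)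
    have "p F E' > r" if E': "E' \<inter> K = E \<inter> K" for E'
    proof -
      have "norm (S A E - S A E') \<le> (\<Sum>\<^sub>\<infinity>k. if k \<in> K then 0 else norm (a A k))" if "A \<in> F" for A
      proof (rule norm_infsum_le)
        have A: "A \<in> G" using that F by auto
        show "((\<lambda>k. (if k \<in> E then a A k else 0) - (if k \<in> E' then a A k else 0)) has_sum (S A E - S A E')) UNIV"
          by (intro has_sum_diff S A)
        show "((\<lambda>k. if k \<in> K then 0 else norm (a A k)) has_sum (\<Sum>\<^sub>\<infinity>k. if k \<in> K then 0 else norm (a A k))) UNIV"
          by (rule has_sum_infsum, rule summable_on_comparison_test[OF row[OF A]]) auto
        show "norm ((if k \<in> E then a A k else 0) - (if k \<in> E' then a A k else 0))
            \<le> (if k \<in> K then 0 else norm (a A k))" for k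
          using E' by auto
      qed
      then have "(\<Sum>A\<in>F. norm (S A E - S A E')) \<le> (\<Sum>A\<in>F. \<Sum>\<^sub>\<infinity>k. if k \<in> K then 0 else norm (a A k))"
        by (rule sum_mono)
      also have "\<dots> = (\<Sum>\<^sub>\<infinity>k. \<Sum>A\<in>F. if k \<in> K then 0 else norm (a A k))"
      proof (rule infsumI[symmetric], rule has_sum_finite_sum)
        fix A assume "A \<in> F"
        then have "A \<in> G" using F by auto
        then show "((\<lambda>k. if k \<in> K then 0 else norm (a A k)) has_sum (\<Sum>\<^sub>\<infinity>k. if k \<in> K then 0 else norm (a A k))) UNIV"
          by (intro has_sum_infsum summable_on_comparison_test[OF row]) auto
      qed
      also have "\<dots> = (\<Sum>\<^sub>\<infinity>k. if k \<in> K then 0 else ?b k)"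
        by (rule infsum_cong) simp
      finally have "(\<Sum>A\<in>F. norm (S A E - S A E')) < p F E - r" using K(2) by linarith
      moreover have "p F E \<le> p F E' + (\<Sum>A\<in>F. norm (S A E - S A E'))"
        unfolding p_def sum.distrib[symmetric]
        by (intro sum_mono) (metis norm_triangle_sub)
      ultimately show ?thesis by linarith
    qed
    then show ?thesis using K(1) by blast
  qed
  have "\<exists>K E r. finite K \<and> (\<forall>E' F. E' \<inter> K = E \<inter> K \<longrightarrow> finite F \<longrightarrow> F \<subseteq> G \<longrightarrow> p F E' \<le> r)"
  proof (rule ccontr)
    assume "\<not> ?thesis"
    then have unbounded: "\<exists>E' F. E' \<inter> K = E \<inter> K \<and> finite F \<and> F \<subseteq> G \<and> p F E' > r" if "finite K" for K E r
      using that by (meson not_le)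
    let ?Q = "\<lambda>n s s'. fst s \<subseteq> fst s' \<and> snd s' \<inter> fst s = snd s \<inter> fst s \<and>
      (\<exists>F. finite F \<and> F \<subseteq> G \<and> (\<forall>E'. E' \<inter> fst s' = snd s' \<inter> fst s' \<longrightarrow> p F E' > real n))"
    have "\<exists>s. \<forall>n. finite (fst (s n)) \<and> ?Q n (s n) (s (Suc n))"
    proof (rule dependent_nat_choice[of "\<lambda>_ s. finite (fst s)" ?Q])
      show "\<exists>s :: 'k set \<times> 'k set. finite (fst s)" by (rule exI[of _ "({}, {})"]) simp
    next
      fix s :: "'k set \<times> 'k set" and n
      assume s: "finite (fst s)"
      obtain E' F where E': "E' \<inter> fst s = snd s \<inter> fst s" "finite F" "F \<subseteq> G" "p F E' > real n"
        using unbounded[OF s, of "snd s" "real n"] by (elim exE conjE) rule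
      obtain K where K: "finite K" "\<And>E''. E'' \<inter> K = E' \<inter> K \<Longrightarrow> p F E'' > real n"
        using open_cylinder[OF E'(2-4)] by (elim exE conjE) auto
      have "p F E'' > real n" if "E'' \<inter> (fst s \<union> K) = E' \<inter> (fst s \<union> K)" for E''
        by (rule K(2)) (use that in blast)
      then have "\<exists>F. finite F \<and> F \<subseteq> G \<and>
          (\<forall>E''. E'' \<inter> (fst s \<union> K) = E' \<inter> (fst s \<union> K) \<longrightarrow> p F E'' > real n)"
        using E'(2,3) by (intro exI[of _ F]) simp
      then show "\<exists>s'. finite (fst s') \<and> ?Q n s s'"
        using s K(1) E'(1) by (intro exI[of _ "(fst s \<union> K, E')"]) simp
    qed
    then obtain s where s: "\<forall>n. finite (fst (s n)) \<and> ?Q n (s n) (s (Suc n))" by (rule exE)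
    define K where "K n = fst (s n)" for n
    define E where "E n = snd (s n)" for n
    have Q: "?Q n (s n) (s (Suc n))" for n by (rule conjunct2[OF spec[OF s]])
    have K_Suc: "K n \<subseteq> K (Suc n)" for n
      unfolding K_def by (rule conjunct1[OF Q])
    have E_Suc: "E (Suc n) \<inter> K n = E n \<inter> K n" for n
      unfolding K_def E_def by (rule conjunct1[OF conjunct2[OF Q]])
    have large: "\<exists>F. finite F \<and> F \<subseteq> G \<and> (\<forall>E'. E' \<inter> K (Suc n) = E (Suc n) \<inter> K (Suc n) \<longrightarrow> p F E' > real n)" for n
      unfolding K_def E_def by (rule conjunct2[OF conjunct2[OF Q]])
    have K_mono: "K m \<subseteq> K n" if "m \<le> n" for m n
      using K_Suc that by (rule lift_Suc_mono_le)
    have E_stable: "E n \<inter> K m = E m \<inter> K m" if "m \<le> n" for m n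
      using that
    proof (induction n rule: dec_induct)
      case (step n)
      then show ?case using E_Suc[of n] K_mono[of m n] by blast
    qed simp
    \<comment> \<open>the limit of the nested cylinders\<close>
    define E\<^sub>\<omega> where "E\<^sub>\<omega> = (\<Union>n. E n \<inter> K n)"
    have agree: "E\<^sub>\<omega> \<inter> K n = E n \<inter> K n" for n
    proof
      show "E\<^sub>\<omega> \<inter> K n \<subseteq> E n \<inter> K n"
      proof
        fix k assume "k \<in> E\<^sub>\<omega> \<inter> K n"
        then obtain m where "k \<in> E m \<inter> K m" "k \<in> K n" by (auto simp: E\<^sub>\<omega>_def)
        then show "k \<in> E n \<inter> K n"
          using E_stable[of m n] E_stable[of n m] by (cases "m \<le> n") auto
      qed
    qed (auto simp: E\<^sub>\<omega>_def)
    obtain n where n: "(\<Sum>\<^sub>\<infinity>A\<in>G. norm (S A E\<^sub>\<omega>)) \<le> real n" using real_arch_simple by blast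
    obtain F where F: "finite F" "F \<subseteq> G" "\<And>E'. E' \<inter> K (Suc n) = E (Suc n) \<inter> K (Suc n) \<Longrightarrow> p F E' > real n"
      using large[of n] by (elim exE conjE) simp
    show False using F(3)[OF agree] p_le[OF F(1,2), of E\<^sub>\<omega>] n by linarith
  qed
  then obtain K E r where K: "finite K"
    and bounded: "\<And>E' F. E' \<inter> K = E \<inter> K \<Longrightarrow> finite F \<Longrightarrow> F \<subseteq> G \<Longrightarrow> p F E' \<le> r" by blast
  define M where "M k = (\<Sum>\<^sub>\<infinity>A\<in>G. norm (S A {k}))" for k
  have single: "S A (insert k E') - S A (E' - {k}) = a A k" if "A \<in> G" for A k E'
  proof -
    have "((\<lambda>l. (if l \<in> insert k E' then a A l else 0) - (if l \<in> E' - {k} then a A l else 0))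
        has_sum (S A (insert k E') - S A (E' - {k}))) UNIV"
      by (intro has_sum_diff S that)
    moreover have "((\<lambda>l. (if l \<in> insert k E' then a A l else 0) - (if l \<in> E' - {k} then a A l else 0))
        has_sum a A k) UNIV"
      by (rule has_sum_finite_neutralI[of "{k}"]) auto
    ultimately show ?thesis by (rule has_sum_unique)
  qed
  have S_empty: "S A {} = 0" for A by (simp add: S_def)
  show ?thesis
  proof (rule that[of "\<bar>2 * r\<bar> + (\<Sum>k\<in>K. M k)"])
    fix k F assume F: "finite F" "F \<subseteq> G"
    have M: "0 \<le> M k" for k unfolding M_def by (intro infsum_nonneg) simp
    show "(\<Sum>A\<in>F. norm (a A k)) \<le> \<bar>2 * r\<bar> + (\<Sum>k\<in>K. M k)"
    proof (cases "k \<in> K")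
      case True
      have "norm (a A k) = norm (S A {k})" if "A \<in> F" for A
        using single[of A k "{}"] that F by (auto simp: S_empty)
      then have "(\<Sum>A\<in>F. norm (a A k)) = p F {k}" unfolding p_def by (intro sum.cong) auto
      also have "\<dots> \<le> M k" unfolding M_def by (rule p_le[OF F])
      also have "\<dots> \<le> (\<Sum>k\<in>K. M k)" using True K M by (intro member_le_sum) auto
      finally show ?thesis by linarith
    next
      case False
      have "norm (a A k) \<le> norm (S A (insert k E)) + norm (S A (E - {k}))" if "A \<in> F" for A
      proof -
        have "A \<in> G" using that F by auto
        then show ?thesis
          using norm_triangle_ineq4[of "S A (insert k E)" "S A (E - {k})"] by (simp add: single)
      qed
      then have "(\<Sum>A\<in>F. norm (a A k)) \<le> p F (insert k E) + p F (E - {k})"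
        unfolding p_def sum.distrib[symmetric] by (rule sum_mono)
      also have "\<dots> \<le> r + r"
        using False by (intro add_mono bounded F) auto
      finally show ?thesis using sum_nonneg[of K M] M by fastforce
    qed
  qed
qed

lemma summable_on_Times_of_column_bound:
  fixes b :: "'a \<Rightarrow> 'k \<Rightarrow> complex"
  assumes M: "M summable_on UNIV"
    and bound: "\<And>k F. finite F \<Longrightarrow> F \<subseteq> G \<Longrightarrow> (\<Sum>A\<in>F. norm (b A k)) \<le> M k"
  shows "(\<lambda>(A, k). b A k) summable_on (G \<times> UNIV)"
proof (rule abs_summable_summable, rule nonneg_bdd_above_summable_on)
  have M0: "0 \<le> M k" for k using bound[of "{}"] by simp
  have "(\<Sum>z\<in>P. norm (case z of (A, k) \<Rightarrow> b A k)) \<le> infsum M UNIV" if P: "finite P" "P \<subseteq> G \<times> UNIV" for P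
  proof -
    have "(\<Sum>z\<in>P. norm (case z of (A, k) \<Rightarrow> b A k)) \<le> (\<Sum>z\<in>fst ` P \<times> snd ` P. norm (case z of (A, k) \<Rightarrow> b A k))"
      using P by (intro sum_mono2) (auto simp: rev_image_eqI)
    also have "\<dots> = (\<Sum>k\<in>snd ` P. \<Sum>A\<in>fst ` P. norm (b A k))"
      unfolding sum.cartesian_product' by (simp add: sum.swap[of _ "fst ` P"])
    also have "\<dots> \<le> (\<Sum>k\<in>snd ` P. M k)"
      using P by (intro sum_mono bound) auto
    also have "\<dots> \<le> infsum M UNIV"
      using P M M0 by (intro finite_sum_le_infsum) auto
    finally show ?thesis .
  qed
  then show "bdd_above (sum (\<lambda>z. norm (case z of (A, k) \<Rightarrow> b A k)) ` {F. F \<subseteq> G \<times> UNIV \<and> finite F})"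
    by (intro bdd_aboveI2) auto
qed simp

section \<open>Rational hyperplanes\<close>

definition perp_hyperplane :: "int ^ 'n \<Rightarrow> (rat ^ 'n) set" where
  "perp_hyperplane k = {a. (\<Sum>i\<in>UNIV. of_int (k $ i) * a $ i) = 0}"

lemma subspace_perp_hyperplane: "vec.subspace (perp_hyperplane k)"
  by (auto simp: perp_hyperplane_def vec.subspace_def distrib_left sum.distrib mult.left_commute
      sum_distrib_left[symmetric])

text \<open>
  Over \<open>\<rat>\<close> the vector \<open>k\<close> is not orthogonal to itself, so it complements its hyperplane.
\<close>

lemma dim_perp_hyperplane:
  fixes k :: "int ^ 'n"
  assumes "k \<noteq> 0"
  shows "vec.dim (perp_hyperplane k) = CARD('n) - 1"
proof -
  let ?H = "perp_hyperplane k" and ?k = "of_int_vec k :: rat ^ 'n"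
  define q where "q a = (\<Sum>i\<in>UNIV. of_int (k $ i) * a $ i)" for a :: "rat ^ 'n"
  have q_add: "q (a + b) = q a + q b" and q_scale: "q (c *s a) = c * q a" for a b c
    by (simp_all add: q_def distrib_left sum.distrib mult.left_commute sum_distrib_left)
  obtain i where i: "k $ i \<noteq> 0" using assms by (auto simp: vec_eq_iff)
  have "0 < (\<Sum>i\<in>UNIV. (of_int (k $ i) :: rat)\<^sup>2)"
    by (rule sum_pos2[of _ i]) (use i in auto)
  then have qk: "q ?k > 0" by (simp add: q_def of_int_vec_def power2_eq_square)
  have H: "?H = {a. q a = 0}" by (simp add: perp_hyperplane_def q_def)
  have span: "vec.span ?H = ?H" using subspace_perp_hyperplane by (rule vec.span_eq_iff[THEN iffD2])
  have "vec.span (insert ?k ?H) = UNIV"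
  proof -
    have "y \<in> vec.span (insert ?k ?H)" for y
    proof -
      let ?c = "q y / q ?k"
      have y: "y + (- ?c) *s ?k \<in> ?H"
        unfolding H using qk by (simp only: mem_Collect_eq q_add q_scale) simp
      have "(y + (- ?c) *s ?k) + ?c *s ?k \<in> vec.span (insert ?k ?H)"
        by (rule vec.span_add[OF vec.span_base[OF insertI2[OF y]] vec.span_scale[OF vec.span_base[OF insertI1]]])
      moreover have "(y + (- ?c) *s ?k) + ?c *s ?k = y"
        by (simp add: vec_eq_iff)
      ultimately show ?thesis by simp
    qed
    then show ?thesis by auto
  qed
  then have "vec.dim (insert ?k ?H) = CARD('n)"
    using vec.dim_span[of "insert ?k ?H"] by (simp add: card_cart_basis vec.dim_UNIV)
  moreover have "vec.dim (insert ?k ?H) = vec.dim ?H + 1"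
  proof -
    have "?k \<notin> vec.span ?H" using qk by (simp only: span) (simp add: H)
    then show ?thesis by (simp add: vec.dim_insert)
  qed
  ultimately show ?thesis by simp
qed

lemma perp_codim_1_iff:
  fixes A :: "(rat ^ 'n) set"
  assumes "k \<noteq> 0" and A: "A \<in> Gr (CARD('n) - 1)"
  shows "perp k A \<longleftrightarrow> A = perp_hyperplane k"
proof
  assume "perp k A"
  then have "A \<subseteq> perp_hyperplane k" by (auto simp: perp_def perp_hyperplane_def)
  then show "A = perp_hyperplane k"
    using A dim_perp_hyperplane[OF assms(1)]
    by (intro vec.subspace_dim_equal subspace_perp_hyperplane) (auto simp: Gr_def)
qed (auto simp: perp_def perp_hyperplane_def)

lemma perp_hyperplane_in_Gr:
  fixes k :: "int ^ 'n"
  shows "k \<noteq> 0 \<Longrightarrow> perp_hyperplane k \<in> Gr (CARD('n) - 1)"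
  by (simp add: Gr_def subspace_perp_hyperplane dim_perp_hyperplane)

text \<open>
  Pairs \<open>(A, k)\<close> with \<open>k \<noteq> 0\<close> and \<open>k \<bottom> A\<close> correspond to the nonzero frequencies, so the sum over
  \<open>A\<close> of the Parseval series of the Radon transforms is a regrouping of the Parseval series of
  \<open>f\<close>. The frequency \<open>0\<close>, orthogonal to every \<open>A\<close>, is harmless because the mean value vanishes.
\<close>

lemma radon_dist_hyperplanes_has_sum:
  fixes f :: "(real ^ 'n \<Rightarrow> complex) \<Rightarrow> complex"
  assumes f: "distribution f" and zero: "fourier_coeff f 0 = 0" and h: "h \<in> test_functions"
  shows "((\<lambda>A. radon_dist (CARD('n) - 1) A f h) has_sum f h) (Gr (CARD('n) - 1))"
proof -
  let ?G = "Gr (CARD('n) - 1) :: (rat ^ 'n) set set"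
  define b where "b k = fourier_coeff f k * torus_coeff h (- k)" for k
  let ?B = "\<lambda>A. {k. k \<noteq> 0 \<and> perp k A}"
  have "(b has_sum f h) UNIV" unfolding b_def by (rule distribution_parseval[OF f h])
  then have b: "(b has_sum f h) (- {0})"
    by (rule has_sum_cong_neutral[THEN iffD1, rotated -1]) (auto simp: b_def zero)
  have "bij_betw snd (Sigma ?G ?B) (- {0})"
    by (rule bij_betw_byWitness[where f' = "\<lambda>k. (perp_hyperplane k, k)"])
       (use perp_hyperplane_in_Gr perp_codim_1_iff in auto)
  then have "((\<lambda>z. b (snd z)) has_sum f h) (Sigma ?G ?B)"
    using b by (subst has_sum_reindex_bij_betw)
  then show ?thesis
  proof (rule has_sum_SigmaD)
    fix A assume A: "A \<in> ?G"
    have "((\<lambda>k. if perp k A then b k else 0) has_sum radon_dist (CARD('n) - 1) A f h) UNIV"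
      unfolding b_def by (rule radon_dist_has_sum[OF f A h])
    then show "((\<lambda>k. b (snd (A, k))) has_sum radon_dist (CARD('n) - 1) A f h) (?B A)"
      by (rule has_sum_cong_neutral[THEN iffD1, rotated -1]) (auto simp: b_def zero)
  qed
qed

section \<open>Summation over planes\<close>

lemma multiplier_term_radon_dist:
  assumes "distribution f" and "A \<in> Gr d"
  shows "multiplier_term (\<lambda>k. of_real (w k A)) (radon_dist d A f) h k
    = (if perp k A then of_real (w k A) * (fourier_coeff f k * torus_coeff h (- k)) else 0)"
  by (simp add: multiplier_term_def fourier_coeff_radon_dist[OF assms])

text \<open>
  Planes not orthogonal to \<open>k\<close> contribute \<open>0\<close>, which reduces the sum to \<open>Omega d k\<close>, where
  the weights add up to \<open>1\<close>.
\<close>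

lemma multiplier_column:
  fixes f :: "(real ^ 'n \<Rightarrow> complex) \<Rightarrow> complex" and h :: "real ^ 'n \<Rightarrow> complex"
    and w :: "int ^ 'n \<Rightarrow> (rat ^ 'n) set \<Rightarrow> real" and k :: "int ^ 'n"
  assumes f: "distribution f"
    and w_summable: "(\<lambda>A. \<bar>w k A\<bar>) summable_on Omega d k"
    and w_sum: "(\<Sum>\<^sub>\<infinity>A\<in>Omega d k. w k A) = 1"
  defines "m A \<equiv> multiplier_term (\<lambda>k. of_real (w k A)) (radon_dist d A f) h k"
  shows "(\<lambda>A. norm (m A)) summable_on Gr d"
    and "(m has_sum fourier_coeff f k * torus_coeff h (- k)) (Gr d)"
proof -
  let ?b = "fourier_coeff f k * torus_coeff h (- k)"
  have m: "m A = (if A \<in> Omega d k then of_real (w k A) * ?b else 0)" if "A \<in> Gr d" for A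
    using multiplier_term_radon_dist[OF f that, of w h k] that by (simp add: m_def Omega_def)
  have sub: "Omega d k \<subseteq> Gr d" by (auto simp: Omega_def)
  have "w k summable_on Omega d k"
    by (rule abs_summable_summable) (simp add: w_summable)
  then have "(w k has_sum 1) (Omega d k)"
    unfolding w_sum[symmetric] by (rule has_sum_infsum)
  then have "((\<lambda>A. of_real (w k A) * ?b) has_sum of_real 1 * ?b) (Omega d k)"
    by (intro has_sum_cmult_left has_sum_of_real)
  then have 1: "((\<lambda>A. of_real (w k A) * ?b) has_sum ?b) (Omega d k)" by simp
  show "(m has_sum ?b) (Gr d)"
    by (rule has_sum_cong_neutral[THEN iffD1, OF _ _ _ 1]) (use sub m in auto)
  have 2: "(\<lambda>A. \<bar>w k A\<bar> * norm ?b) summable_on Omega d k"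
    by (intro summable_on_cmult_left w_summable)
  show "(\<lambda>A. norm (m A)) summable_on Gr d"
    by (rule summable_on_cong_neutral[THEN iffD1, OF _ _ _ 2])
       (use sub m in \<open>auto simp: norm_mult\<close>)
qed

text \<open>
  Rapid decay survives restriction of the frequencies and polynomial weights. This freedom is what
  allows hypotheses on all test functions to be exploited one frequency at a time.
\<close>

lemma filtered_test_function:
  fixes h :: "real ^ 'n \<Rightarrow> complex"
  assumes h: "h \<in> test_functions"
  obtains g where "g \<in> test_functions"
    and "\<And>k. torus_coeff g (- k) = (if k \<in> E then of_real ((weight k)\<^sup>2) * torus_coeff h (- k) else 0)"
proof -
  let ?c = "\<lambda>k. if - k \<in> E then of_real ((weight k)\<^sup>2) * torus_coeff h k else 0"
  have c: "rapid ?c"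
    by (rule rapid_dominated[OF rapid_torus_coeff[OF h], of _ 1 2]) (simp add: norm_mult norm_power)
  show ?thesis
    by (rule that[of "trig_series ?c"])
       (simp_all add: trig_series_test_function[OF c] torus_coeff_trig_series[OF c])
qed

text \<open>
  The uniform column bound is applied to the terms multiplied by \<open>(weight k)\<^sup>2\<close>; dividing by the
  weight again leaves column sums dominated by the summable \<open>B / (weight k)\<^sup>2\<close>.
\<close>

lemma summable_on_pairs_of_iterated:
  fixes f :: "(real ^ 'n \<Rightarrow> complex) \<Rightarrow> complex" and w :: "int ^ 'n \<Rightarrow> (rat ^ 'n) set \<Rightarrow> real"
    and d :: nat
  defines "m \<equiv> \<lambda>h A. multiplier_term (\<lambda>k. of_real (w k A)) (radon_dist d A f) h"
  assumes row: "\<And>h A. h \<in> test_functions \<Longrightarrow> A \<in> Gr d \<Longrightarrow> m h A summable_on UNIV"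
    and outer: "\<And>h. h \<in> test_functions \<Longrightarrow> (\<lambda>A. infsum (m h A) UNIV) summable_on Gr d"
    and h: "h \<in> test_functions"
  shows "(\<lambda>(A, k). m h A k) summable_on (Gr d \<times> UNIV)"
proof -
  define a where "a A k = of_real ((weight k)\<^sup>2) * m h A k" for A k
  have filtered: "\<exists>g\<in>test_functions. \<forall>A. m g A = (\<lambda>k. if k \<in> E then a A k else 0)" for E
  proof -
    obtain g where g: "g \<in> test_functions"
      "\<And>k. torus_coeff g (- k) = (if k \<in> E then of_real ((weight k)\<^sup>2) * torus_coeff h (- k) else 0)"
      using filtered_test_function[OF h] by blast
    have "m g A = (\<lambda>k. if k \<in> E then a A k else 0)" for A
      by (simp add: fun_eq_iff m_def a_def multiplier_term_def g(2) mult_ac)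
    then show ?thesis using g(1) by blast
  qed
  obtain B where B: "\<And>k F. finite F \<Longrightarrow> F \<subseteq> Gr d \<Longrightarrow> (\<Sum>A\<in>F. norm (a A k)) \<le> B"
  proof (rule uniform_column_bound[of "Gr d" a])
    fix A :: "(rat ^ 'n) set" assume A: "A \<in> Gr d"
    obtain g where "g \<in> test_functions" "m g A = (\<lambda>k. if k \<in> UNIV then a A k else 0)"
      using filtered by blast
    then have "a A summable_on UNIV" using row[OF _ A] by force
    then show "(\<lambda>k. norm (a A k)) summable_on UNIV"
      by (simp add: summable_on_iff_abs_summable_on_complex)
  next
    fix E
    obtain g where "g \<in> test_functions" "\<And>A. m g A = (\<lambda>k. if k \<in> E then a A k else 0)"
      using filtered by blast
    then have "(\<lambda>A. \<Sum>\<^sub>\<infinity>k. if k \<in> E then a A k else 0) summable_on Gr d"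
      using outer by force
    then show "(\<lambda>A. norm (\<Sum>\<^sub>\<infinity>k. if k \<in> E then a A k else 0)) summable_on Gr d"
      by (simp add: summable_on_iff_abs_summable_on_complex)
  qed blast
  show ?thesis
  proof (rule summable_on_Times_of_column_bound)
    show "(\<lambda>k :: int ^ 'n. B * (1 / (weight k)\<^sup>2)) summable_on UNIV"
      by (intro summable_on_cmult_right summable_inverse_weight_square)
    fix k :: "int ^ 'n" and F :: "(rat ^ 'n) set set"
    assume F: "finite F" "F \<subseteq> Gr d"
    have "norm (m h A k) = norm (a A k) / (weight k)\<^sup>2" for A
      using less_imp_neq[OF weight_pos[of k]] by (simp add: a_def norm_mult norm_power)
    then show "(\<Sum>A\<in>F. norm (m h A k)) \<le> B * (1 / (weight k)\<^sup>2)"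
      using B[OF F, of k] by (simp add: sum_divide_distrib[symmetric] divide_right_mono)
  qed
qed

lemma has_sum_rows_of_columns:
  fixes b :: "'a \<Rightarrow> 'k \<Rightarrow> complex"
  assumes pairs: "(\<lambda>(A, k). b A k) summable_on (G \<times> UNIV)"
    and column: "\<And>k. ((\<lambda>A. b A k) has_sum c k) G" and total: "(c has_sum s) UNIV"
  shows "((\<lambda>A. infsum (b A) UNIV) has_sum s) G"
proof -
  obtain t where t: "((\<lambda>(A, k). b A k) has_sum t) (G \<times> UNIV)"
    using pairs by (auto simp: summable_on_def)
  then have "((\<lambda>(k, A). b A k) has_sum t) (UNIV \<times> G)"
    by (subst has_sum_swap) simp
  then have "(c has_sum t) UNIV"
    by (rule has_sum_SigmaD) (simp add: column)
  then have "t = s" using total by (rule has_sum_unique)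
  moreover have "((\<lambda>A. infsum (b A) UNIV) has_sum t) G"
    using t
  proof (rule has_sum_SigmaD)
    fix A assume "A \<in> G"
    then have "(\<lambda>k. (case (A, k) of (A, k) \<Rightarrow> b A k)) summable_on UNIV"
      using summable_on_SigmaD1[of b G "\<lambda>_. UNIV" A] pairs by simp
    then show "((\<lambda>k. (case (A, k) of (A, k) \<Rightarrow> b A k)) has_sum infsum (b A) UNIV) UNIV"
      using has_sum_infsum by fastforce
  qed
  ultimately show ?thesis by simp
qed

theorem theorem4p11:
  fixes f :: "(real ^ 'n \<Rightarrow> complex) \<Rightarrow> complex"
    and w :: "int ^ 'n \<Rightarrow> (rat ^ 'n) set \<Rightarrow> real"
    and d :: nat
  assumes "CARD('n) \<ge> 2"
    and "1 \<le> d" and "d \<le> CARD('n) - 1"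
    and "distribution f"
    and "\<And>k. (\<lambda>A. \<bar>w k A\<bar>) summable_on Omega d k"
    and "\<And>k. (\<Sum>\<^sub>\<infinity>A\<in>Omega d k. w k A) = 1"
  shows
    "(\<forall>h\<in>test_functions.
        (\<forall>k. (\<lambda>A. norm (multiplier_term (\<lambda>k. of_real (w k A)) (radon_dist d A f) h k))
               summable_on Gr d) \<and>
        ((\<lambda>k. \<Sum>\<^sub>\<infinity>A\<in>Gr d. multiplier_term (\<lambda>k. of_real (w k A)) (radon_dist d A f) h k)
           has_sum f h) UNIV) \<and>
     (\<forall>h\<in>test_functions.
        (\<lambda>(A, k). multiplier_term (\<lambda>k. of_real (w k A)) (radon_dist d A f) h k)
          summable_on (Gr d \<times> UNIV) \<longrightarrow>
        ((\<lambda>A. fourier_multiplier (\<lambda>k. of_real (w k A)) (radon_dist d A f) h)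
           has_sum f h) (Gr d)) \<and>
     ((\<forall>h\<in>test_functions.
         (\<forall>A\<in>Gr d. multiplier_term (\<lambda>k. of_real (w k A)) (radon_dist d A f) h
            summable_on UNIV) \<and>
         (\<lambda>A. fourier_multiplier (\<lambda>k. of_real (w k A)) (radon_dist d A f) h)
            summable_on Gr d) \<longrightarrow>
      (\<forall>h\<in>test_functions.
         ((\<lambda>A. fourier_multiplier (\<lambda>k. of_real (w k A)) (radon_dist d A f) h)
            has_sum f h) (Gr d))) \<and>
     (fourier_coeff f 0 = 0 \<and> d = CARD('n) - 1 \<longrightarrow>
      (\<forall>h\<in>test_functions. ((\<lambda>A. radon_dist d A f h) has_sum f h) (Gr d)))"
proof -
  note f = \<open>distribution f\<close>
  let ?m = "\<lambda>h A k. multiplier_term (\<lambda>k. of_real (w k A)) (radon_dist d A f) h k"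
  have column: "((\<lambda>A. ?m h A k) has_sum fourier_coeff f k * torus_coeff h (- k)) (Gr d)"
    and column_abs: "(\<lambda>A. norm (?m h A k)) summable_on Gr d" for h k
    by (rule multiplier_column[where w = w and k = k, OF f assms(5) assms(6)])+
  have total: "((\<lambda>k. \<Sum>\<^sub>\<infinity>A\<in>Gr d. ?m h A k) has_sum f h) UNIV" if "h \<in> test_functions" for h
    using distribution_parseval[OF f that] by (simp add: infsumI[OF column])
  have exchange: "((\<lambda>A. fourier_multiplier (\<lambda>k. of_real (w k A)) (radon_dist d A f) h) has_sum f h) (Gr d)"
    if "h \<in> test_functions" and "(\<lambda>(A, k). ?m h A k) summable_on (Gr d \<times> UNIV)" for h
    unfolding fourier_multiplier_def
    by (rule has_sum_rows_of_columns[OF that(2) column distribution_parseval[OF f that(1)]])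
  have iterated: "(\<lambda>(A, k). ?m h A k) summable_on (Gr d \<times> UNIV)"
    if "\<forall>h\<in>test_functions. (\<forall>A\<in>Gr d. ?m h A summable_on UNIV) \<and>
      (\<lambda>A. fourier_multiplier (\<lambda>k. of_real (w k A)) (radon_dist d A f) h) summable_on Gr d"
      and "h \<in> test_functions" for h
    using that unfolding fourier_multiplier_def by (intro summable_on_pairs_of_iterated) auto
  show ?thesis
  proof (intro conjI ballI allI impI)
    fix h :: "real ^ 'n \<Rightarrow> complex" assume h: "h \<in> test_functions"
    show "(\<lambda>A. norm (?m h A k)) summable_on Gr d" for k by (rule column_abs)
    show "((\<lambda>k. \<Sum>\<^sub>\<infinity>A\<in>Gr d. ?m h A k) has_sum f h) UNIV" by (rule total[OF h])
    show "((\<lambda>A. fourier_multiplier (\<lambda>k. of_real (w k A)) (radon_dist d A f) h) has_sum f h) (Gr d)"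
      if "(\<lambda>(A, k). ?m h A k) summable_on (Gr d \<times> UNIV)"
      by (rule exchange[OF h that])
    show "((\<lambda>A. fourier_multiplier (\<lambda>k. of_real (w k A)) (radon_dist d A f) h) has_sum f h) (Gr d)"
      if "\<forall>h\<in>test_functions. (\<forall>A\<in>Gr d. ?m h A summable_on UNIV) \<and>
        (\<lambda>A. fourier_multiplier (\<lambda>k. of_real (w k A)) (radon_dist d A f) h) summable_on Gr d"
      by (rule exchange[OF h iterated[OF that h]])
    show "((\<lambda>A. radon_dist d A f h) has_sum f h) (Gr d)"
      if "fourier_coeff f 0 = 0 \<and> d = CARD('n) - 1"
      using radon_dist_hyperplanes_has_sum[OF f _ h] that by simp
  qed
qed

end
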